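(* Fix an exact zero-quality desk selector $r$, let $V^{0,r}$ be the associated zero-quality strategic value, and define the gross quality gain $$\Gamma^{0,r}(\mu,p)=D^0(\mu,p)\{p+V^{0,r}(J^0(\mu,p),p)-V^{0,r}(\mu,p)\},\qquad c^*(r)=\sup_{(\mu,p)\in[0,1]\times\mathcal P}\Gamma^{0,r}(\mu,p).$$ Then: (a) The zero-quality assessment $(a\equiv 0,r)$ is sequentially rational for the strategic type if and only if $c\ge c^*(r)$. (b) If $c>c^*(r)$, it has a strict uniform obedience margin: there is $\eta>0$ with $\Gamma^{0,r}(\mu,p)-c\le-\eta$ for all $(\mu,p)\in[0,1]\times\mathcal P$. (c) The threshold is indexed by the selector: if desk price ties affect continuation values (that is, if $V^{0,r}$ differs across exact selectors), the threshold is $c^*(r)$ for the selector $r$ in use. Isolated event-time-null ties are immaterial: if two exact selectors $r,s$ differ only at isolated tie beliefs that are event-time null, then $c^*(r)=c^*(s)$.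
   Context: **Model.** Constants: $\rho,\nu,\kappa,v,\zeta>0$ (discount rate, customer arrival rate, price-reset rate, value of high quality, logit scale), quality cost $c>0$, signal precision $q\in(1/2,1)$, $d=2q-1$. Prices lie in a finite menu $\mathcal P\subset(0,\infty)$. A firm is of type $C$ (always high quality) or $S$ (strategic, chooses high or low quality at each customer opportunity; high quality costs $c$, low is free). $\mu\in[0,1]$ is the public probability of type $C$. For $\lambda\in[0,1]$ put $\pi_H(\lambda)=\frac{q\lambda}{(1-q)+d\lambda}$, $\pi_L(\lambda)=\frac{(1-q)\lambda}{q-d\lambda}$, $\Lambda(z)=e^z/(1+e^z)$, $b_s(\lambda,p)=\Lambda((v\pi_s(\lambda)-p)/\zeta)$ for $s\in\{H,L\}$. **Zero-quality objects** (assessed strategic quality $a\equiv0$, so expected quality is $\lambda=\mu$): $A_H^0(\mu,p)=qb_H(\mu,p)+(1-q)b_L(\mu,p)$, $A_L^0=(1-q)b_H+qb_L$, $D^0=A_H^0-A_L^0=d(b_H-b_L)$, $\bar A^0=A_L^0+\mu D^0$, silence drift $\beta^0=-\nu\mu(1-\mu)D^0$, purchase posterior $J^0=\mu A_H^0/\bar A^0$. Let $\phi^p_t(\mu)$ be the flow of $\dot\mu=\beta^0(\mu,p)$ with $p$ fixed. Public purchases arrive at rate $\nu\bar A^0$ (rate $\nu A^0_L$ conditional on type $S$) and move $\mu$ to $J^0$ leaving $p$ unchanged; resets arrive at rate $\kappa$, leave $\mu$ unchanged and let a pricing desk choose a new price. **Desk.** Gross aggregate value $\widetilde U^0$ is the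 unique bounded fixed point of $$(\mathcal Tf)(\mu,p)=\int_0^\infty e^{-\rho t}S_p(t)\big[\nu p\bar A^0(\phi_t,p)+\kappa\max_{p'\in\mathcal P}f(\phi_t,p')+\nu\bar A^0(\phi_t,p)f(J^0(\phi_t,p),p)\big]dt,$$ with $\phi_t=\phi_t^p(\mu)$ and $S_p(t)=\exp\{-\int_0^t[\kappa+\nu\bar A^0(\phi_s,p)]ds\}$. An exact zero-quality desk selector is a Borel probability kernel $r(\cdot\mid\mu,p)$ on $\mathcal P$ supported on $\arg\max_{p'\in\mathcal P}\widetilde U^0(\mu,p')$ (dependence on the old price $p$ is only tie-breaking). **Strategic value.** $V^{0,r}$ is the unique bounded solution of $$V(\mu,p)=\int_0^\infty e^{-\rho t-\int_0^t[\kappa+\nu A_L^0(\phi_s,p)]ds}\Big[\nu pA_L^0(\phi_t,p)+\kappa\sum_{p'}r(p'\mid\phi_t,p)V(\phi_t,p')+\nu A_L^0(\phi_t,p)V(J^0(\phi_t,p),p)\Big]dt.$$ **Sequential rationality of $(a\equiv0,r)$.** A one-shot switch by type $S$ from low to high quality at a customer opportunity in state $(\mu,p)$ leaves the customer purchase rule, the public filter, the desk kernel and continuation values fixed; it raises the purchase probability from $A_L^0$ to $A_H^0$ and costs $c$; a purchase yields $p$ and continuation $V^{0,r}(J^0,p)$ rather than $V^{0,r}(\mu,p)$. The assessment is sequentially rational for type $S$ if at no state-price pair $(\mu,p)\in[0,1]\times\mathcal P$ such a switch is strictly profitable. **Event-time null.** A set of beliefs $N$ is event-time null if from every initial state the expected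 discounted number of resets occurring while $\mu\in N$ is zero. *)

theory Defs
  imports "HOL-Probability.Probability"
begin

record pricing_model =
  discount_rate :: real
  arrival_rate :: real
  reset_rate :: real
  quality_value :: real
  logit_scale :: real
  signal_precision :: real
  price_menu :: "real set"

definition valid_model :: "pricing_model \<Rightarrow> bool" where
  "valid_model M \<longleftrightarrow>
     discount_rate M > 0 \<and> arrival_rate M > 0 \<and> reset_rate M > 0 \<and>
     quality_value M > 0 \<and> logit_scale M > 0 \<and>
     1 / 2 < signal_precision M \<and> signal_precision M < 1 \<and>
     finite (price_menu M) \<and> price_menu M \<noteq> {} \<and> price_menu M \<subseteq> {0<..}"

text \<open>A state is a pair of a public belief and a posted price.\<close>

definition states :: "pricing_model \<Rightarrow> (real \<times> real) set" where
  "states M = {0..1} \<times> price_menu M"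

subsection \<open>Customers and the public filter when assessed strategic quality is zero\<close>

definition informativeness :: "pricing_model \<Rightarrow> real" where
  "informativeness M = 2 * signal_precision M - 1"

definition pi_H :: "pricing_model \<Rightarrow> real \<Rightarrow> real" where
  "pi_H M l = signal_precision M * l / ((1 - signal_precision M) + informativeness M * l)"

definition pi_L :: "pricing_model \<Rightarrow> real \<Rightarrow> real" where
  "pi_L M l = (1 - signal_precision M) * l / (signal_precision M - informativeness M * l)"

definition logistic :: "real \<Rightarrow> real" where
  "logistic z = exp z / (1 + exp z)"

definition b_H :: "pricing_model \<Rightarrow> real \<Rightarrow> real \<Rightarrow> real" where
  "b_H M l p = logistic ((quality_value M * pi_H M l - p) / logit_scale M)"

definition b_L :: "pricing_model \<Rightarrow> real \<Rightarrow> real \<Rightarrow> real" where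
  "b_L M l p = logistic ((quality_value M * pi_L M l - p) / logit_scale M)"

definition A_H :: "pricing_model \<Rightarrow> real \<Rightarrow> real \<Rightarrow> real" where
  "A_H M m p = signal_precision M * b_H M m p + (1 - signal_precision M) * b_L M m p"

definition A_L :: "pricing_model \<Rightarrow> real \<Rightarrow> real \<Rightarrow> real" where
  "A_L M m p = (1 - signal_precision M) * b_H M m p + signal_precision M * b_L M m p"

definition D0 :: "pricing_model \<Rightarrow> real \<Rightarrow> real \<Rightarrow> real" where
  "D0 M m p = A_H M m p - A_L M m p"

definition A_bar :: "pricing_model \<Rightarrow> real \<Rightarrow> real \<Rightarrow> real" where
  "A_bar M m p = A_L M m p + m * D0 M m p"

definition silence_drift :: "pricing_model \<Rightarrow> real \<Rightarrow> real \<Rightarrow> real" where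
  "silence_drift M m p = - arrival_rate M * m * (1 - m) * D0 M m p"

definition purchase_posterior :: "pricing_model \<Rightarrow> real \<Rightarrow> real \<Rightarrow> real" where
  "purchase_posterior M m p = m * A_H M m p / A_bar M m p"

text \<open>\<open>flow M p m t\<close> is the belief after silence of length \<open>t \<ge> 0\<close> at price \<open>p\<close>, started
  from \<open>m\<close>. Trajectories are functions on \<open>{0..}\<close>; extensionality only fixes their irrelevant
  values at negative times, so that the description is of a single HOL function.\<close>

definition flow :: "pricing_model \<Rightarrow> real \<Rightarrow> real \<Rightarrow> real \<Rightarrow> real" where
  "flow M p m = (THE x. x \<in> {0..} \<rightarrow>\<^sub>E {0..1} \<and> x 0 = m \<and>
     (\<forall>t\<ge>0. (x has_real_derivative silence_drift M (x t) p) (at t within {0..})))"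

text \<open>Probability of no reset and no purchase up to time \<open>t\<close>, when each arriving customer buys
  with probability \<open>A\<close>. The public law has \<open>A = A_bar M\<close>; the law given the strategic type
  has \<open>A = A_L M\<close>.\<close>

definition survival ::
    "pricing_model \<Rightarrow> (real \<Rightarrow> real \<Rightarrow> real) \<Rightarrow> real \<Rightarrow> real \<Rightarrow> real \<Rightarrow> real" where
  "survival M A m p t =
     exp (- (LBINT s:{0..t}. reset_rate M + arrival_rate M * A (flow M p m s) p))"

subsection \<open>The pricing desk\<close>

text \<open>Bounded solutions are sought among Borel functions, so that the integrals are genuine;
  values outside \<^term>\<open>states M\<close> are normalised by extensionality.\<close>

definition bounded_borel :: "pricing_model \<Rightarrow> (real \<times> real \<Rightarrow> real) set" where
  "bounded_borel M = {f \<in> extensional (states M). bounded (f ` states M) \<and>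
     (\<forall>p\<in>price_menu M. (\<lambda>m. f (m, p)) \<in> borel_measurable (restrict_space borel {0..1}))}"

definition desk_operator ::
    "pricing_model \<Rightarrow> (real \<times> real \<Rightarrow> real) \<Rightarrow> real \<times> real \<Rightarrow> real" where
  "desk_operator M f = (\<lambda>(m, p). LBINT t:{0..}.
     exp (- discount_rate M * t) * survival M (A_bar M) m p t *
     (let x = flow M p m t in
        arrival_rate M * p * A_bar M x p
        + reset_rate M * Max ((\<lambda>p'. f (x, p')) ` price_menu M)
        + arrival_rate M * A_bar M x p * f (purchase_posterior M x p, p)))"

definition desk_value :: "pricing_model \<Rightarrow> real \<times> real \<Rightarrow> real" where
  "desk_value M =
     (THE f. f \<in> bounded_borel M \<and> (\<forall>x\<in>states M. f x = desk_operator M f x))"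

definition optimal_prices :: "pricing_model \<Rightarrow> real \<Rightarrow> real set" where
  "optimal_prices M m =
     {p. is_arg_max (\<lambda>p'. desk_value M (m, p')) (\<lambda>p'. p' \<in> price_menu M) p}"

definition tie_beliefs :: "pricing_model \<Rightarrow> real set" where
  "tie_beliefs M = {m \<in> {0..1}. card (optimal_prices M m) \<ge> 2}"

text \<open>Since the menu is finite, a family of probability mass functions is a Borel kernel as soon
  as every point mass depends measurably on the belief, for each old price.\<close>

type_synonym selector = "real \<times> real \<Rightarrow> real pmf"

definition exact_selector :: "pricing_model \<Rightarrow> selector \<Rightarrow> bool" where
  "exact_selector M r \<longleftrightarrow>
     (\<forall>p\<in>price_menu M. \<forall>p'\<in>price_menu M.
        (\<lambda>m. pmf (r (m, p)) p') \<in> borel_measurable (restrict_space borel {0..1})) \<and>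
     (\<forall>m\<in>{0..1}. \<forall>p\<in>price_menu M. set_pmf (r (m, p)) \<subseteq> optimal_prices M m)"

subsection \<open>The strategic type\<close>

definition strategic_operator ::
    "pricing_model \<Rightarrow> selector \<Rightarrow> (real \<times> real \<Rightarrow> real) \<Rightarrow> real \<times> real \<Rightarrow> real" where
  "strategic_operator M r f = (\<lambda>(m, p). LBINT t:{0..}.
     exp (- discount_rate M * t) * survival M (A_L M) m p t *
     (let x = flow M p m t in
        arrival_rate M * p * A_L M x p
        + reset_rate M * (\<Sum>p'\<in>price_menu M. pmf (r (x, p)) p' * f (x, p'))
        + arrival_rate M * A_L M x p * f (purchase_posterior M x p, p)))"

definition strategic_value :: "pricing_model \<Rightarrow> selector \<Rightarrow> real \<times> real \<Rightarrow> real" where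
  "strategic_value M r =
     (THE f. f \<in> bounded_borel M \<and> (\<forall>x\<in>states M. f x = strategic_operator M r f x))"

text \<open>Expected payoff of type S at a customer opportunity in state \<open>(m, p)\<close> when the customer
  buys with probability \<open>a\<close>, the cost of quality not included.\<close>

definition opportunity_payoff ::
    "pricing_model \<Rightarrow> selector \<Rightarrow> real \<Rightarrow> real \<Rightarrow> real \<Rightarrow> real" where
  "opportunity_payoff M r m p a =
     a * (p + strategic_value M r (purchase_posterior M m p, p))
     + (1 - a) * strategic_value M r (m, p)"

definition profitable_switch ::
    "pricing_model \<Rightarrow> real \<Rightarrow> selector \<Rightarrow> real \<Rightarrow> real \<Rightarrow> bool" where
  "profitable_switch M c r m p \<longleftrightarrow>
     opportunity_payoff M r m p (A_H M m p) - c > opportunity_payoff M r m p (A_L M m p)"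

definition sequentially_rational :: "pricing_model \<Rightarrow> real \<Rightarrow> selector \<Rightarrow> bool" where
  "sequentially_rational M c r \<longleftrightarrow> \<not> (\<exists>(m, p)\<in>states M. profitable_switch M c r m p)"

definition gross_gain :: "pricing_model \<Rightarrow> selector \<Rightarrow> real \<Rightarrow> real \<Rightarrow> real" where
  "gross_gain M r m p =
     D0 M m p *
     (p + strategic_value M r (purchase_posterior M m p, p) - strategic_value M r (m, p))"

definition cost_threshold :: "pricing_model \<Rightarrow> selector \<Rightarrow> real" where
  "cost_threshold M r = (SUP (m, p)\<in>states M. gross_gain M r m p)"

subsection \<open>Event-time null sets\<close>

text \<open>Events are resets and purchases. With \<open>T\<close> the time of event number \<open>n\<close> (counted from 0),
  \<open>discounted_reset M A r N n (m, p)\<close> is the expectation, from initial state \<open>(m, p)\<close>, of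
  \<open>exp (- \<rho> T)\<close> on the event that event number \<open>n\<close> is a reset occurring at a belief in \<open>N\<close>.
  It is computed by conditioning on the first event; \<open>A\<close> selects the law as in
  \<^const>\<open>survival\<close>.\<close>

primrec discounted_reset ::
    "pricing_model \<Rightarrow> (real \<Rightarrow> real \<Rightarrow> real) \<Rightarrow> selector \<Rightarrow> real set \<Rightarrow> nat
      \<Rightarrow> real \<times> real \<Rightarrow> ennreal" where
  "discounted_reset M A r N 0 = (\<lambda>(m, p).
     \<integral>\<^sup>+ t. indicator {0..} t * ennreal (exp (- discount_rate M * t) * survival M A m p t) *
        (ennreal (reset_rate M) * indicator N (flow M p m t)) \<partial>lborel)"
| "discounted_reset M A r N (Suc n) = (\<lambda>(m, p).
     \<integral>\<^sup>+ t. indicator {0..} t * ennreal (exp (- discount_rate M * t) * survival M A m p t) *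
        (let x = flow M p m t in
           ennreal (reset_rate M) *
             (\<Sum>p'\<in>price_menu M. ennreal (pmf (r (x, p)) p') * discounted_reset M A r N n (x, p'))
           + ennreal (arrival_rate M * A x p) *
             discounted_reset M A r N n (purchase_posterior M x p, p)) \<partial>lborel)"

definition expected_discounted_resets ::
    "pricing_model \<Rightarrow> (real \<Rightarrow> real \<Rightarrow> real) \<Rightarrow> selector \<Rightarrow> real set \<Rightarrow> real \<times> real \<Rightarrow> ennreal"
  where
  "expected_discounted_resets M A r N x = (\<Sum>n. discounted_reset M A r N n x)"

definition event_time_null ::
    "pricing_model \<Rightarrow> (real \<Rightarrow> real \<Rightarrow> real) \<Rightarrow> selector \<Rightarrow> real set \<Rightarrow> bool" where
  "event_time_null M A r N \<longleftrightarrow>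
     N \<in> sets borel \<and> (\<forall>x\<in>states M. expected_discounted_resets M A r N x = 0)"

definition disagreement :: "pricing_model \<Rightarrow> selector \<Rightarrow> selector \<Rightarrow> real set" where
  "disagreement M r s = {m \<in> {0..1}. \<exists>p\<in>price_menu M. r (m, p) \<noteq> s (m, p)}"

end

theory Submission
  imports Defs
begin

text \<open>One-shot deviations pay exactly the gross gain, so everything rests on the strategic value
  being a genuine bounded function. The silence belief solves a Lipschitz equation that preserves
  \<open>[0, 1]\<close>, hence the flow exists, is unique and is jointly continuous. Along it, let \<open>h\<close> be the
  total event rate, which is at most \<open>R = \<kappa> + \<nu>\<close>. The discounted survival weight \<open>E\<close>
  satisfies \<open>- E' = (\<rho> + h) E\<close>, so that \<open>\<integral> E h \<le> R / (\<rho> + R) < 1\<close>: the strategic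
  operator is a contraction in the supremum norm. If the beliefs where two selectors disagree are
  event-time null, then already the first event shows that every silence path spends zero time
  there; both selectors then have the same operator, and so the same value.\<close>

subsection \<open>Autonomous Lipschitz equations on the half line\<close>

text \<open>The flow and the strategic value are definite descriptions and the threshold is a real
  supremum; none of them says anything until existence and uniqueness, or an upper bound, is proved,
  and most of the work goes there. The fixed point lives among Borel functions, so the operator must
  return Borel functions of the initial belief. This requires measurability jointly in belief and
  time, which joint continuity of the flow provides. The rate bound \<kappa> + \<nu> holds because
  purchase probabilities are below 1, and R / (\<rho> + R) appears because h / (\<rho> + h)
  increases in h while E (\<rho> + h) has total mass 1. From exactness the contraction takes that
  the kernel spreads unit mass over the menu, which makes the reset term an average of continuation
  values.\<close>

lemma integral_has_real_derivative_atLeast: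
  fixes g :: "real \<Rightarrow> real"
  assumes "continuous_on {a..} g" "a \<le> t"
  shows "((\<lambda>x. integral {a..x} g) has_real_derivative g t) (at t within {a..})"
proof -
  have "((\<lambda>x. integral {a..x} g) has_real_derivative g t) (at t within {a..t+1})"
    using assms by (intro integral_has_real_derivative continuous_on_subset[OF assms(1)]) auto
  moreover have "at t within {a..t+1} = at t within {a..}"
    by (rule at_within_nhd[of t "{..<t+1}"]) auto
  ultimately show ?thesis by simp
qed

text \<open>The derivative is taken within \<open>{0..}\<close>, hence one-sided at 0, to match the
  condition in \<open>flow\<close>.\<close>

definition solves_ode_atLeast :: "(real \<Rightarrow> real) \<Rightarrow> (real \<Rightarrow> real) \<Rightarrow> bool" where
  "solves_ode_atLeast F x \<longleftrightarrow> (\<forall>t\<ge>0. (x has_real_derivative F (x t)) (at t within {0..}))"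

lemma solves_ode_atLeast_continuous:
  assumes "solves_ode_atLeast F x"
  shows "continuous_on {0..} x"
  using assms unfolding solves_ode_atLeast_def
  by (intro DERIV_continuous_on[where D="\<lambda>t. F (x t)"]) auto

text \<open>Serves to restart a trajectory at the moment it meets an end point of [0, 1], where
  uniqueness can then be applied.\<close>

lemma solves_ode_atLeast_shift:
  assumes "solves_ode_atLeast F x" "s \<ge> 0"
  shows "solves_ode_atLeast F (\<lambda>t. x (s + t))"
  unfolding solves_ode_atLeast_def
proof (intro allI impI)
  fix t :: real assume "t \<ge> 0"
  have "(x has_real_derivative F (x (s + t))) (at (s + t) within {0..})"
    using assms \<open>t \<ge> 0\<close> unfolding solves_ode_atLeast_def by auto
  then have "(x has_real_derivative F (x (s + t))) (at (s + t) within (\<lambda>t. s + t) ` {0..})"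
    by (rule DERIV_subset) (use assms in auto)
  moreover have "((\<lambda>t. s + t) has_real_derivative 1) (at t within {0..})"
    by (auto intro!: derivative_eq_intros)
  ultimately show "((\<lambda>t. x (s + t)) has_real_derivative F (x (s + t))) (at t within {0..})"
    using DERIV_image_chain[of x "F (x (s + t))" "\<lambda>t. s + t" t "{0..}" 1] by (simp add: o_def)
qed

text \<open>Gronwall's argument on the squared distance, which stays differentiable where the
  trajectories meet: its derivative is at most 2 L times itself, so the weight exp (- 2 L t) makes
  it nonincreasing. It yields both uniqueness and Lipschitz dependence on the initial belief. The
  domain \<open>X\<close> is a parameter since the silence drift will be Lipschitz on
  [0, 1].\<close>

lemma solves_ode_atLeast_dist:
  assumes F: "L-lipschitz_on X F"
    and x: "solves_ode_atLeast F x" "\<And>t. t \<ge> 0 \<Longrightarrow> x t \<in> X"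
    and y: "solves_ode_atLeast F y" "\<And>t. t \<ge> 0 \<Longrightarrow> y t \<in> X"
    and "t \<ge> 0"
  shows "\<bar>x t - y t\<bar> \<le> exp (L * t) * \<bar>x 0 - y 0\<bar>"
proof -
  define g where "g = (\<lambda>t. (x t - y t)\<^sup>2 * exp (- 2 * L * t))"
  have "g t \<le> g 0"
  proof (rule DERIV_nonpos_imp_decreasing_open[OF \<open>t \<ge> 0\<close>])
    fix s assume s: "0 < s" "s < t"
    have at: "at s within {0..} = at s"
      using s by (intro at_within_interior) auto
    have "(x has_real_derivative F (x s)) (at s)" "(y has_real_derivative F (y s)) (at s)"
      using x(1) y(1) less_imp_le[OF s(1)] unfolding solves_ode_atLeast_def at[symmetric] by blast+
    then have "(g has_real_derivative
        2 * (x s - y s) * (F (x s) - F (y s)) * exp (- 2 * L * s)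
        - 2 * L * (x s - y s)\<^sup>2 * exp (- 2 * L * s)) (at s)"
      unfolding g_def by (auto intro!: derivative_eq_intros simp: algebra_simps)
    moreover have "(x s - y s) * (F (x s) - F (y s)) \<le> L * (x s - y s)\<^sup>2"
    proof -
      have "\<bar>F (x s) - F (y s)\<bar> \<le> L * \<bar>x s - y s\<bar>"
        using lipschitz_onD[OF F, of "x s" "y s"] x(2) y(2) s by (simp add: dist_real_def)
      then have "\<bar>x s - y s\<bar> * \<bar>F (x s) - F (y s)\<bar> \<le> \<bar>x s - y s\<bar> * (L * \<bar>x s - y s\<bar>)"
        by (intro mult_left_mono) auto
      moreover have "(x s - y s) * (F (x s) - F (y s)) \<le> \<bar>x s - y s\<bar> * \<bar>F (x s) - F (y s)\<bar>"
        by (metis abs_ge_self abs_mult)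
      moreover have "\<bar>x s - y s\<bar> * (L * \<bar>x s - y s\<bar>) = L * \<bar>x s - y s\<bar>\<^sup>2"
        by (simp add: power2_eq_square)
      ultimately show ?thesis by simp
    qed
    then have "(2 * ((x s - y s) * (F (x s) - F (y s))) - 2 * (L * (x s - y s)\<^sup>2)) * exp (- 2 * L * s) \<le> 0"
      by (intro mult_nonpos_nonneg) auto
    then have "2 * (x s - y s) * (F (x s) - F (y s)) * exp (- 2 * L * s)
        - 2 * L * (x s - y s)\<^sup>2 * exp (- 2 * L * s) \<le> 0"
      by (simp only: left_diff_distrib mult.assoc)
    ultimately show "\<exists>y. (g has_real_derivative y) (at s) \<and> y \<le> 0"
      by blast
  next
    have "continuous_on {0..t} x" "continuous_on {0..t} y"
      using solves_ode_atLeast_continuous[OF x(1)] solves_ode_atLeast_continuous[OF y(1)]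
      by (auto intro: continuous_on_subset)
    then show "continuous_on {0..t} g"
      unfolding g_def by (intro continuous_intros)
  qed
  then have "(x t - y t)\<^sup>2 * exp (- 2 * L * t) * exp (2 * L * t) \<le> (x 0 - y 0)\<^sup>2 * exp (2 * L * t)"
    unfolding g_def by (intro mult_right_mono) auto
  then have "(x t - y t)\<^sup>2 * (exp (- 2 * L * t) * exp (2 * L * t)) \<le> (x 0 - y 0)\<^sup>2 * exp (2 * L * t)"
    by (simp only: mult.assoc)
  moreover have "exp (- 2 * L * t) * exp (2 * L * t) = 1"
    by (simp flip: exp_add)
  moreover have "exp (2 * L * t) = (exp (L * t))\<^sup>2"
    by (metis exp_double mult.assoc)
  ultimately have "(x t - y t)\<^sup>2 \<le> (exp (L * t) * (x 0 - y 0))\<^sup>2"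
    by (metis mult.commute mult_1_right power_mult_distrib)
  then show ?thesis
    by (simp add: abs_le_square_iff[symmetric] abs_mult)
qed

lemma solves_ode_atLeast_unique:
  assumes "L-lipschitz_on X F"
    and "solves_ode_atLeast F x" "\<And>t. t \<ge> 0 \<Longrightarrow> x t \<in> X"
    and "solves_ode_atLeast F y" "\<And>t. t \<ge> 0 \<Longrightarrow> y t \<in> X"
    and "x 0 = y 0" "t \<ge> 0"
  shows "x t = y t"
  using solves_ode_atLeast_dist[OF assms(1-5) \<open>t \<ge> 0\<close>] \<open>x 0 = y 0\<close> by simp

text \<open>Picard iteration for \<open>w t = exp (- 2 L t) * x t\<close>: the weight makes the integral operator a
  contraction with factor 1/2 on bounded continuous functions.\<close>

lemma solves_ode_atLeast_exists:
  fixes F :: "real \<Rightarrow> real"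
  assumes F: "L-lipschitz_on UNIV F" and "L > 0" and B: "\<And>x. \<bar>F x\<bar> \<le> B"
  shows "\<exists>x. solves_ode_atLeast F x \<and> x 0 = m"
proof -
  define K where "K = 2 * L"
  have "K > 0" using \<open>L > 0\<close> by (simp add: K_def)
  have "B \<ge> 0" using B[of 0] by linarith
  have Fc: "continuous_on UNIV F"
    using F by (rule lipschitz_on_continuous_on)
  define G where "G w s = F (exp (K * s) * w s)" for w s
  \<comment> \<open>Continued to negative times by its value m at 0, so that it acts on bounded
    continuous functions on the whole line, which form a complete space.\<close>
  define I where "I w t = exp (- K * max 0 t) * (m + integral {0..max 0 t} (G w))"
    for w :: "real \<Rightarrow> real" and t
  have Gc: "continuous_on A (G w)" if "continuous_on UNIV w" for w A
    unfolding G_def using that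
    by (intro continuous_on_compose2[OF Fc] continuous_intros) (auto intro: continuous_on_subset)
  have Gi: "G w integrable_on {a..b}" if "continuous_on UNIV w" for w a b
    using Gc[OF that] by (rule integrable_continuous_real)
  have deriv: "((\<lambda>x. integral {0..x} (G w)) has_real_derivative G w t) (at t within {0..})"
    if "continuous_on UNIV w" "t \<ge> 0" for w t
    by (intro integral_has_real_derivative_atLeast Gc that)
  have Ic: "continuous_on UNIV (I w)" if w: "continuous_on UNIV w" for w
  proof -
    have "continuous_on {0..} (\<lambda>x. integral {0..x} (G w))"
      using deriv[OF w] by (intro DERIV_continuous_on[where D="G w"]) auto
    then have "continuous_on UNIV (\<lambda>t. integral {0..max 0 t} (G w))"
      by (rule continuous_on_compose2) (auto intro!: continuous_intros)
    then show ?thesis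
      unfolding I_def by (intro continuous_intros)
  qed
  \<comment> \<open>A bounded field lets the primitive grow at most linearly, and the weight absorbs
    this: u exp (- K u) is at most 1 / K.\<close>
  have Ib: "\<bar>I w t\<bar> \<le> \<bar>m\<bar> + B / K" if w: "continuous_on UNIV w" for w t
  proof -
    define u where "u = max 0 t"
    have "u \<ge> 0" by (simp add: u_def)
    have "\<bar>integral {0..u} (G w)\<bar> \<le> B * (u - 0)"
      using integral_bound[of 0 u "G w" B] \<open>u \<ge> 0\<close> Gc[OF w] B by (auto simp: G_def)
    then have "\<bar>m + integral {0..u} (G w)\<bar> \<le> \<bar>m\<bar> + B * u"
      using abs_triangle_ineq[of m "integral {0..u} (G w)"] by simp
    then have "exp (- K * u) * \<bar>m + integral {0..u} (G w)\<bar> \<le> exp (- K * u) * (\<bar>m\<bar> + B * u)"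
      by (intro mult_left_mono) auto
    also have "\<dots> = exp (- K * u) * \<bar>m\<bar> + B * (u * exp (- K * u))"
      by (simp add: algebra_simps)
    also have "\<dots> \<le> \<bar>m\<bar> + B * (1 / K)"
    proof (intro add_mono mult_left_mono \<open>B \<ge> 0\<close>)
      have "exp (- K * u) \<le> 1" using \<open>K > 0\<close> \<open>u \<ge> 0\<close> by simp
      then show "exp (- K * u) * \<bar>m\<bar> \<le> \<bar>m\<bar>"
        by (intro mult_left_le_one_le) auto
      have "K * u \<le> exp (K * u)"
        using exp_ge_add_one_self[of "K * u"] by linarith
      then show "u * exp (- K * u) \<le> 1 / K"
        using \<open>K > 0\<close> by (simp add: exp_minus field_simps)
    qed
    finally show ?thesis
      by (simp add: I_def u_def abs_mult)
  qed
  have Ibc: "I w \<in> bcontfun" if "continuous_on UNIV w" for w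
    using Ic[OF that] Ib[OF that] by (intro bcontfun_normI) auto
  define P where "P w = Bcontfun (I (apply_bcontfun w))" for w :: "real \<Rightarrow>\<^sub>C real"
  have P: "apply_bcontfun (P w) = I (apply_bcontfun w)" for w
    unfolding P_def by (intro Bcontfun_inverse Ibc) auto
  have "dist (P v) (P w) \<le> 1/2 * dist v w" for v w
  proof (rule dist_bound)
    fix t :: real
    define u where "u = max 0 t"
    define \<delta> where "\<delta> = dist v w"
    have "u \<ge> 0" by (simp add: u_def)
    let ?v = "apply_bcontfun v" and ?w = "apply_bcontfun w"
    have vw: "\<bar>?v s - ?w s\<bar> \<le> \<delta>" for s
      using dist_bounded[of v s w] by (simp add: \<delta>_def dist_real_def)
    \<comment> \<open>Origin of K = 2 L: this integral is at most (L / K) exp (K u) \<delta>, so the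
      contraction factor is L / K.\<close>
    have exp_int: "((\<lambda>s. L * exp (K * s) * \<delta>) has_integral
        L * exp (K * u) * \<delta> / K - L * exp (K * 0) * \<delta> / K) {0..u}"
      using \<open>u \<ge> 0\<close> \<open>K > 0\<close>
      by (intro fundamental_theorem_of_calculus)
        (auto intro!: derivative_eq_intros simp flip: has_real_derivative_iff_has_vector_derivative)
    have "\<bar>integral {0..u} (G ?v) - integral {0..u} (G ?w)\<bar> = \<bar>integral {0..u} (\<lambda>s. G ?v s - G ?w s)\<bar>"
      by (subst integral_diff) (auto intro!: Gi)
    also have "\<dots> \<le> integral {0..u} (\<lambda>s. L * exp (K * s) * \<delta>)"
      unfolding real_norm_def[symmetric]
    proof (rule integral_norm_bound_integral)
      show "(\<lambda>s. G ?v s - G ?w s) integrable_on {0..u}"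
        by (intro integrable_diff Gi) auto
      show "(\<lambda>s. L * exp (K * s) * \<delta>) integrable_on {0..u}"
        using exp_int by blast
      fix s
      have "\<bar>G ?v s - G ?w s\<bar> \<le> L * \<bar>exp (K * s) * ?v s - exp (K * s) * ?w s\<bar>"
        using lipschitz_onD[OF F] by (simp add: G_def dist_real_def)
      also have "\<dots> = L * exp (K * s) * \<bar>?v s - ?w s\<bar>"
        by (simp add: abs_mult flip: right_diff_distrib)
      also have "\<dots> \<le> L * exp (K * s) * \<delta>"
        using vw \<open>L > 0\<close> by (intro mult_left_mono) auto
      finally show "norm (G ?v s - G ?w s) \<le> L * exp (K * s) * \<delta>" by simp
    qed
    also have "\<dots> = L * exp (K * u) * \<delta> / K - L * \<delta> / K"
      using integral_unique[OF exp_int] by simp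
    also have "\<dots> \<le> exp (K * u) * (1/2 * \<delta>)"
      using \<open>L > 0\<close> by (simp add: K_def \<delta>_def)
    finally have "exp (- K * u) * \<bar>integral {0..u} (G ?v) - integral {0..u} (G ?w)\<bar>
        \<le> exp (- K * u) * (exp (K * u) * (1/2 * \<delta>))"
      by (intro mult_left_mono) auto
    also have "\<dots> = 1/2 * \<delta>"
      by (simp add: exp_minus field_simps)
    finally have "\<bar>exp (- K * u) * (integral {0..u} (G ?v) - integral {0..u} (G ?w))\<bar> \<le> 1/2 * \<delta>"
      by (simp add: abs_mult)
    moreover have "I ?v t - I ?w t = exp (- K * u) * (integral {0..u} (G ?v) - integral {0..u} (G ?w))"
      unfolding I_def u_def by (simp add: algebra_simps)
    ultimately show "dist (apply_bcontfun (P v) t) (apply_bcontfun (P w) t) \<le> 1/2 * dist v w"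
      by (simp add: P dist_real_def \<delta>_def)
  qed
  then obtain w where "P w = w"
    using banach_fix_type[of "1/2" P] by auto
  then have w: "I (apply_bcontfun w) t = apply_bcontfun w t" for t
    using P by metis
  define x where "x t = m + integral {0..t} (G (apply_bcontfun w))" for t
  have x: "exp (K * t) * apply_bcontfun w t = x t" if "t \<ge> 0" for t
    using that unfolding w[symmetric, of t] I_def x_def by (simp add: max_absorb2 flip: mult.assoc exp_add)
  have "solves_ode_atLeast F x"
    unfolding solves_ode_atLeast_def
  proof (intro allI impI)
    fix t :: real assume "t \<ge> 0"
    have "(x has_real_derivative 0 + G (apply_bcontfun w) t) (at t within {0..})"
      unfolding x_def using \<open>t \<ge> 0\<close> by (intro DERIV_add DERIV_const deriv) auto
    then show "(x has_real_derivative F (x t)) (at t within {0..})"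
      using x[OF \<open>t \<ge> 0\<close>] by (simp add: G_def)
  qed
  then show ?thesis by (intro exI[of _ x]) (auto simp: x_def)
qed

text \<open>A trajectory cannot leave \<open>[0, 1]\<close>: both end points are equilibria of the field frozen at
  its end point values.\<close>

lemma solves_ode_unit_interval_exists:
  fixes F :: "real \<Rightarrow> real"
  assumes F: "L-lipschitz_on {0..1} F" and F0: "F 0 = 0" and F1: "F 1 = 0"
    and m: "m \<in> {0..1}"
  shows "\<exists>x. solves_ode_atLeast F x \<and> x 0 = m \<and> (\<forall>t\<ge>0. x t \<in> {0..1})"
proof -
  \<comment> \<open>Freezing the field outside [0, 1] makes it bounded and Lipschitz on the whole
    line, as Picard iteration asks; the trajectory turns out never to see the change.\<close>
  define cl :: "real \<Rightarrow> real" where "cl x = max 0 (min 1 x)" for x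
  have cl: "cl x \<in> {0..1}" for x by (auto simp: cl_def)
  define H where "H x = F (cl x)" for x
  have "L \<ge> 0" using F by (rule lipschitz_on_nonneg)
  \<comment> \<open>L may be 0, while the existence lemma wants a positive constant.\<close>
  have HL: "(L + 1)-lipschitz_on UNIV H"
  proof (rule lipschitz_onI)
    fix x y :: real
    have "dist (H x) (H y) \<le> L * dist (cl x) (cl y)"
      unfolding H_def using F cl cl by (rule lipschitz_onD)
    also have "\<dots> \<le> L * dist x y"
      using \<open>L \<ge> 0\<close> by (intro mult_left_mono) (auto simp: cl_def dist_real_def)
    also have "\<dots> \<le> (L + 1) * dist x y"
      by (intro mult_right_mono) auto
    finally show "dist (H x) (H y) \<le> (L + 1) * dist x y" .
  qed (use \<open>L \<ge> 0\<close> in auto)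
  have HB: "\<bar>H x\<bar> \<le> L" for x
  proof -
    have "\<bar>F (cl x) - F 0\<bar> \<le> L * \<bar>cl x - 0\<bar>"
      using lipschitz_onD[OF F cl, of 0] by (simp add: dist_real_def)
    also have "\<dots> \<le> L * 1"
      using cl[of x] \<open>L \<ge> 0\<close> by (intro mult_left_mono) auto
    finally show ?thesis by (simp add: H_def F0)
  qed
  obtain x where x: "solves_ode_atLeast H x" "x 0 = m"
    using solves_ode_atLeast_exists[OF HL _ HB] \<open>L \<ge> 0\<close> by force
  note xc = solves_ode_atLeast_continuous[OF x(1)]
  \<comment> \<open>Uniqueness against the constant solution. A trajectory found outside [0, 1] must
    have crossed an end point earlier, and would have stayed there.\<close>
  have stuck: "x t = e" if "0 \<le> s" "s \<le> t" "x s = e" "H e = 0" for s t e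
  proof -
    have "solves_ode_atLeast H (\<lambda>_. e)"
      using that(4) by (simp add: solves_ode_atLeast_def)
    from solves_ode_atLeast_unique[OF HL solves_ode_atLeast_shift[OF x(1) that(1)] _ this, of "t - s"]
    show ?thesis using that by simp
  qed
  have range: "x t \<in> {0..1}" if "t \<ge> 0" for t
  proof (rule ccontr)
    assume "x t \<notin> {0..1}"
    then consider "x t < 0" | "x t > 1" by force
    then show False
    proof cases
      case 1
      then obtain s where "0 \<le> s" "s \<le> t" "x s = 0"
        using IVT2'[of x t 0 0] m x(2) \<open>t \<ge> 0\<close> continuous_on_subset[OF xc, of "{0..t}"] by auto
      with stuck[of s t 0] 1 show False by (simp add: H_def cl_def F0)
    next
      case 2
      then obtain s where "0 \<le> s" "s \<le> t" "x s = 1"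
        using IVT'[of x 0 1 t] m x(2) \<open>t \<ge> 0\<close> continuous_on_subset[OF xc, of "{0..t}"] by auto
      with stuck[of s t 1] 2 show False by (simp add: H_def cl_def F1)
    qed
  qed
  have "H (x t) = F (x t)" if "t \<ge> 0" for t
    using range[OF that] by (auto simp: H_def cl_def max_absorb2 min_absorb2)
  then have "solves_ode_atLeast F x"
    using x(1) by (simp add: solves_ode_atLeast_def)
  then show ?thesis using x(2) range by blast
qed

subsection \<open>Discounting with a hazard rate\<close>

text \<open>Read discounting as an independent killing clock of rate \<rho>. Then E (\<rho> + h) is
  the density of the first ring among killing and events, with total mass 1, and the integral of E h
  is the probability that an event comes before killing.\<close>

lemma discounted_hazard_integral:
  fixes h :: "real \<Rightarrow> real"
  assumes hc: "continuous_on {0..} h"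
    and h0: "\<And>t. t \<ge> 0 \<Longrightarrow> 0 \<le> h t" and hR: "\<And>t. t \<ge> 0 \<Longrightarrow> h t \<le> R" and "\<rho> > 0"
  defines "E \<equiv> \<lambda>t. exp (- \<rho> * t) * exp (- (LBINT s:{0..t}. h s))"
  shows "set_integrable lborel {0..} (\<lambda>t. E t * h t)"
    and "(LBINT t:{0..}. E t * h t) \<le> R / (\<rho> + R)"
proof -
  have R: "R \<ge> 0" using h0[of 0] hR[of 0] by simp
  define k where "k s = h (max 0 s)" for s
  have kc: "continuous_on A k" for A
    unfolding k_def by (intro continuous_on_compose2[OF hc] continuous_intros) auto
  \<comment> \<open>starting the integral at -1 makes the primitive differentiable from both sides at 0\<close>
  define J where "J t = integral {-1..t} k - integral {-1..0} k" for t
  have J: "J t = (LBINT s:{0..t}. h s)" if "t \<ge> 0" for t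
  proof -
    have "integral {-1..0} k + integral {0..t} k = integral {-1..t} k"
      using that by (intro Henstock_Kurzweil_Integration.integral_combine
          integrable_continuous_real kc) auto
    moreover have "integral {0..t} k = integral {0..t} h"
      by (intro integral_cong) (auto simp: k_def)
    moreover have "(LBINT s:{0..t}. h s) = integral {0..t} h"
      by (intro set_borel_integral_eq_integral borel_integrable_atLeastAtMost'
          continuous_on_subset[OF hc]) auto
    ultimately show ?thesis by (simp add: J_def)
  qed
  have J0: "J t \<ge> 0" if "t \<ge> 0" for t
    unfolding J[OF that] set_lebesgue_integral_def
    by (intro Bochner_Integration.integral_nonneg) (auto simp: indicator_def h0)
  have dJ: "(J has_real_derivative k t) (at t)" if "t \<ge> 0" for t
  proof -
    have "((\<lambda>x. integral {-1..x} k) has_real_derivative k t) (at t within {-1..})"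
      using that by (intro integral_has_real_derivative_atLeast kc) auto
    moreover have "at t within {-1..} = at t"
      using that by (intro at_within_interior) auto
    ultimately show ?thesis
      unfolding J_def by (auto intro!: derivative_eq_intros)
  qed
  define e where "e t = exp (- \<rho> * t - J t)" for t
  have eE: "e t = E t" if "t \<ge> 0" for t
    using J[OF that] by (simp add: e_def E_def flip: exp_add)
  have de: "(e has_real_derivative - (e t * (\<rho> + k t))) (at t)" if "t \<ge> 0" for t
    unfolding e_def using dJ[OF that]
    by (auto intro!: derivative_eq_intros simp: algebra_simps)
  have ec: "continuous_on {0..} e"
    using de by (intro continuous_at_imp_continuous_on ballI DERIV_isCont) auto
  define f where "f t = indicator {0..} t *\<^sub>R (e t * (\<rho> + k t))" for t
  have f_borel: "f \<in> borel_measurable borel"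
    unfolding f_def using ec kc
    by (intro borel_measurable_continuous_on_indicator continuous_intros) auto
  have f_nonneg: "f t \<ge> 0" for t
    using h0 \<open>\<rho> > 0\<close> by (auto simp: f_def indicator_def e_def k_def)
  have "((\<lambda>t. - e t) \<longlongrightarrow> 0) at_top"
  proof -
    have "((\<lambda>t. exp (- \<rho> * t)) \<longlongrightarrow> 0) at_top"
      using \<open>\<rho> > 0\<close> by real_asymp
    moreover have "\<forall>\<^sub>F t in at_top. norm (- e t) \<le> exp (- \<rho> * t)"
      using eventually_ge_at_top[of 0] by eventually_elim (simp add: e_def J0)
    ultimately show ?thesis by (rule Lim_null_comparison[rotated])
  qed
  then have "(\<integral>\<^sup>+x. ennreal (f x) * indicator {0..} x \<partial>lborel) = 0 - (- e 0)"
    using DERIV_minus[OF de] by (intro nn_integral_FTC_atLeast f_borel f_nonneg) (auto simp: f_def)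
  also have "e 0 = 1"
    by (simp add: e_def J_def)
  also have "(\<integral>\<^sup>+x. ennreal (f x) * indicator {0..} x \<partial>lborel) = (\<integral>\<^sup>+x. ennreal (f x) \<partial>lborel)"
    by (intro nn_integral_cong) (auto simp: f_def indicator_def)
  finally have "has_bochner_integral lborel f 1"
    using f_borel f_nonneg by (intro has_bochner_integral_nn_integral) auto
  then have f: "integrable lborel f" "integral\<^sup>L lborel f = 1"
    by (auto simp: has_bochner_integral_iff)
  define g where "g t = indicator {0..} t *\<^sub>R (e t * k t)" for t
  have g_borel: "g \<in> borel_measurable borel"
    unfolding g_def using ec kc
    by (intro borel_measurable_continuous_on_indicator continuous_intros) auto
  have g: "g t \<le> R / (\<rho> + R) * f t" "g t \<ge> 0" for t
  proof -
    show "g t \<le> R / (\<rho> + R) * f t"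
    proof (cases "t \<ge> 0")
      case True
      \<comment> \<open>Monotonicity of x / (\<rho> + x), with denominators cleared.\<close>
      have "k t * (\<rho> + R) \<le> R * (\<rho> + k t)"
        using hR[of t] True \<open>\<rho> > 0\<close> by (simp add: k_def algebra_simps)
      then have "k t \<le> R / (\<rho> + R) * (\<rho> + k t)"
        using \<open>\<rho> > 0\<close> R by (simp add: field_simps)
      then have "e t * k t \<le> e t * (R / (\<rho> + R) * (\<rho> + k t))"
        by (intro mult_left_mono) (auto simp: e_def)
      then show ?thesis using True by (simp add: g_def f_def mult.left_commute)
    qed (simp add: g_def f_def)
    show "g t \<ge> 0"
      using h0 by (auto simp: g_def indicator_def e_def k_def)
  qed
  have gi: "integrable lborel g"
    by (rule Bochner_Integration.integrable_bound[OF integrable_mult_right[OF f(1), of "R / (\<rho> + R)"]])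
      (use g g_borel f_nonneg R \<open>\<rho> > 0\<close> in \<open>auto simp: abs_of_nonneg\<close>)
  have gE: "g t = indicator {0..} t *\<^sub>R (E t * h t)" for t
    using eE[of t] by (auto simp: g_def indicator_def k_def)
  show "set_integrable lborel {0..} (\<lambda>t. E t * h t)"
    using gi by (simp add: set_integrable_def gE[abs_def])
  have "integral\<^sup>L lborel g \<le> integral\<^sup>L lborel (\<lambda>t. R / (\<rho> + R) * f t)"
    using g gi f by (intro integral_mono) auto
  then show "(LBINT t:{0..}. E t * h t) \<le> R / (\<rho> + R)"
    using f by (simp add: set_lebesgue_integral_def gE[abs_def])
qed

subsection \<open>Contractions in the supremum norm\<close>

text \<open>Banach's theorem for a set of functions instead of a complete metric type:
  \<open>bounded_borel\<close> is cut out by measurability and extensionality, so completeness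
  enters as closure under uniform limits. \<open>T f\<close> need only agree on \<open>X\<close>
  with a member of \<open>B\<close>, because the strategic operator is not extensional outside the
  states.\<close>

lemma sup_norm_contraction_fixed_point:
  fixes T :: "('a \<Rightarrow> real) \<Rightarrow> 'a \<Rightarrow> real"
  assumes f0: "f0 \<in> B"
    and T: "\<And>f. f \<in> B \<Longrightarrow> \<exists>g\<in>B. \<forall>x\<in>X. g x = T f x"
    and bdd: "\<And>f g. f \<in> B \<Longrightarrow> g \<in> B \<Longrightarrow> \<exists>\<delta>. \<forall>x\<in>X. \<bar>f x - g x\<bar> \<le> \<delta>"
    and con: "\<And>f g \<delta> x. f \<in> B \<Longrightarrow> g \<in> B \<Longrightarrow> \<forall>x\<in>X. \<bar>f x - g x\<bar> \<le> \<delta> \<Longrightarrow> x \<in> X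
      \<Longrightarrow> \<bar>T f x - T g x\<bar> \<le> \<theta> * \<delta>"
    and \<theta>: "0 \<le> \<theta>" "\<theta> < 1"
    and lim: "\<And>s g. (\<And>n. s n \<in> B) \<Longrightarrow> uniform_limit X s g sequentially
      \<Longrightarrow> \<exists>g'\<in>B. \<forall>x\<in>X. g' x = g x"
    and ext: "\<And>f g. f \<in> B \<Longrightarrow> g \<in> B \<Longrightarrow> \<forall>x\<in>X. f x = g x \<Longrightarrow> f = g"
  shows "\<exists>!f. f \<in> B \<and> (\<forall>x\<in>X. f x = T f x)"
proof -
  obtain U where U: "\<And>f. f \<in> B \<Longrightarrow> U f \<in> B" "\<And>f x. f \<in> B \<Longrightarrow> x \<in> X \<Longrightarrow> U f x = T f x"
    using T by metis
  define s where "s n = (U ^^ n) f0" for n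
  have sB: "s n \<in> B" for n
    by (induction n) (simp_all add: s_def f0 U)
  have sSuc: "s (Suc n) x = T (s n) x" if "x \<in> X" for n x
    using U(2)[OF sB that] by (simp add: s_def)
  obtain \<delta> where \<delta>: "\<forall>x\<in>X. \<bar>s 1 x - s 0 x\<bar> \<le> \<delta>"
    using bdd[OF sB sB] by blast
  have step: "\<forall>x\<in>X. \<bar>s (Suc n) x - s n x\<bar> \<le> \<delta> * \<theta> ^ n" for n
  proof (induction n)
    case (Suc n)
    show ?case
      using con[OF sB sB Suc] by (simp add: sSuc mult_ac)
  qed (use \<delta> in simp)
  define g where "g x = (\<Sum>i. s (Suc i) x - s i x) + s 0 x" for x
  have "uniform_limit X (\<lambda>n x. \<Sum>i<n. s (Suc i) x - s i x) (\<lambda>x. \<Sum>i. s (Suc i) x - s i x) sequentially"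
    using step \<theta>
    by (intro Weierstrass_m_test[where M="\<lambda>n. \<delta> * \<theta> ^ n"])
      (auto intro!: summable_mult summable_geometric)
  then have "uniform_limit X s g sequentially"
    unfolding g_def uniform_limit_iff sum_lessThan_telescope[of "\<lambda>n. s n x" for x] dist_real_def
    by (simp add: diff_diff_eq add.commute)
  moreover from lim[OF sB this] obtain f where f: "f \<in> B" "\<forall>x\<in>X. f x = g x" by blast
  ultimately have ul: "uniform_limit X s f sequentially"
    by (auto simp: uniform_limit_iff)
  have "f x = T f x" if "x \<in> X" for x
  proof (rule LIMSEQ_unique)
    show "(\<lambda>n. s (Suc n) x) \<longlonglongrightarrow> f x"
      using tendsto_uniform_limitI[OF ul that] by (rule LIMSEQ_Suc)
    show "(\<lambda>n. s (Suc n) x) \<longlonglongrightarrow> T f x"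
    proof (rule metric_LIMSEQ_I)
      fix e :: real assume "e > 0"
      then obtain N where N: "\<And>n. n \<ge> N \<Longrightarrow> \<forall>x\<in>X. dist (s n x) (f x) < e"
        using uniform_limitD[OF ul] by (auto simp: eventually_sequentially)
      have "dist (s (Suc n) x) (T f x) < e" if "n \<ge> N" for n
      proof -
        have "\<bar>T (s n) x - T f x\<bar> \<le> \<theta> * e"
          using N[OF that] by (intro con sB f \<open>x \<in> X\<close>) (auto simp: dist_real_def intro: less_imp_le)
        also have "\<dots> < e" using \<theta> \<open>e > 0\<close> by simp
        finally show ?thesis by (simp add: sSuc[OF \<open>x \<in> X\<close>] dist_real_def)
      qed
      then show "\<exists>N. \<forall>n\<ge>N. dist (s (Suc n) x) (T f x) < e" by blast
    qed
  qed
  moreover have "f = f'" if f': "f' \<in> B" "\<forall>x\<in>X. f' x = T f' x" and ff: "\<forall>x\<in>X. f x = T f x" for f'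
  proof -
    obtain \<gamma> where \<gamma>: "\<forall>x\<in>X. \<bar>f x - f' x\<bar> \<le> \<gamma>"
      using bdd[OF f(1) f'(1)] by blast
    have "\<forall>x\<in>X. \<bar>f x - f' x\<bar> \<le> \<theta> ^ n * \<gamma>" for n
    proof (induction n)
      case (Suc n)
      show ?case
      proof
        fix x assume "x \<in> X"
        have "\<bar>T f x - T f' x\<bar> \<le> \<theta> ^ Suc n * \<gamma>"
          using con[OF f(1) f'(1) Suc \<open>x \<in> X\<close>] by (simp add: mult.assoc)
        then show "\<bar>f x - f' x\<bar> \<le> \<theta> ^ Suc n * \<gamma>"
          using f'(2) ff \<open>x \<in> X\<close> by metis
      qed
    qed (use \<gamma> in simp)
    moreover have "(\<lambda>n. \<theta> ^ n * \<gamma>) \<longlonglongrightarrow> 0"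
      using \<theta> by (auto intro!: tendsto_mult_left_zero LIMSEQ_power_zero)
    ultimately have "\<bar>f x - f' x\<bar> \<le> 0" if "x \<in> X" for x
      using that by (intro LIMSEQ_le_const) auto
    then show ?thesis
      using f(1) f'(1) by (intro ext) auto
  qed
  ultimately show ?thesis using f(1) by (intro ex1I[of _ f]) metis+
qed

subsection \<open>Clamping to the unit interval\<close>

definition unit_clamp :: "real \<Rightarrow> real" where
  "unit_clamp x = max 0 (min 1 x)"

lemma unit_clamp_range [simp]: "0 \<le> unit_clamp x" "unit_clamp x \<le> 1"
  by (auto simp: unit_clamp_def)

lemma unit_clamp_id: "x \<in> {0..1} \<Longrightarrow> unit_clamp x = x"
  by (auto simp: unit_clamp_def)

lemma borel_measurable_unit_clamp [measurable]: "unit_clamp \<in> borel_measurable borel"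
  unfolding unit_clamp_def[abs_def] by measurable

text \<open>Trades the subspace for the whole line: once beliefs are clamped, all functions are
  total and joint measurability can be shown on the plane.\<close>

lemma borel_measurable_restrict_unit_iff:
  "g \<in> borel_measurable (restrict_space borel {0..1}) \<longleftrightarrow> (\<lambda>x. g (unit_clamp x)) \<in> borel_measurable borel"
  for g :: "real \<Rightarrow> real"
proof
  assume g: "g \<in> borel_measurable (restrict_space borel {0..1})"
  have "unit_clamp \<in> borel \<rightarrow>\<^sub>M restrict_space borel {0..1}"
    by (intro measurable_restrict_space2) auto
  from measurable_compose[OF this g] show "(\<lambda>x. g (unit_clamp x)) \<in> borel_measurable borel" .
next
  assume "(\<lambda>x. g (unit_clamp x)) \<in> borel_measurable borel"
  then have "(\<lambda>x. g (unit_clamp x)) \<in> borel_measurable (restrict_space borel {0..1})"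
    by (rule measurable_restrict_space1)
  then show "g \<in> borel_measurable (restrict_space borel {0..1})"
    by (rule measurable_cong[THEN iffD1, rotated]) (auto simp: unit_clamp_id space_restrict_space)
qed

subsection \<open>Purchase probabilities and the silence flow\<close>

lemma convex_unit_less:
  fixes a b w :: real
  assumes "0 < a" "a < 1" "0 < b" "b < 1" "0 \<le> w" "w \<le> 1"
  shows "0 < (1 - w) * a + w * b" "(1 - w) * a + w * b < 1"
proof -
  have "min a b \<le> (1 - w) * a + w * b" "(1 - w) * a + w * b \<le> max a b"
    using convex_bound_le[of a "max a b" b "1 - w" w] convex_bound_le[of "-a" "- min a b" "-b" "1 - w" w] assms
    by auto
  then show "0 < (1 - w) * a + w * b" "(1 - w) * a + w * b < 1"
    using assms by linarith+
qed

lemma logistic_bounds: "0 < logistic z" "logistic z < 1"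
  unfolding logistic_def by (simp_all add: add_pos_pos)

lemma DERIV_logistic:
  "(logistic has_real_derivative logistic z * (1 - logistic z)) (at z)"
proof -
  have "1 + exp z \<noteq> 0" using exp_gt_zero[of z] by linarith
  then show ?thesis
    unfolding logistic_def[abs_def]
    by (auto intro!: derivative_eq_intros simp: field_simps)
qed

text \<open>These hold on the whole line, since total division is Borel even where a denominator
  vanishes.\<close>

lemma borel_measurable_model [measurable]:
  "(\<lambda>m. A_L M m p) \<in> borel_measurable borel"
  "(\<lambda>m. A_bar M m p) \<in> borel_measurable borel"
  "(\<lambda>m. purchase_posterior M m p) \<in> borel_measurable borel"
  unfolding purchase_posterior_def A_bar_def D0_def A_H_def A_L_def b_H_def b_L_def pi_H_def pi_L_def
    logistic_def
  by measurable

locale pricing_market =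
  fixes M :: pricing_model
  assumes valid: "valid_model M"
begin

abbreviation "\<nu> \<equiv> arrival_rate M"
abbreviation "\<kappa> \<equiv> reset_rate M"
abbreviation "\<rho> \<equiv> discount_rate M"
abbreviation "q \<equiv> signal_precision M"

lemma params:
  "\<rho> > 0" "\<nu> > 0" "\<kappa> > 0" "quality_value M > 0" "logit_scale M > 0" "q > 1/2" "q < 1"
  "finite (price_menu M)" "price_menu M \<noteq> {}" "\<And>p. p \<in> price_menu M \<Longrightarrow> p > 0"
  using valid unfolding valid_model_def by auto

lemma A_L_bounds: "0 < A_L M m p" "A_L M m p < 1"
  using convex_unit_less[of "b_H M m p" "b_L M m p" q] params logistic_bounds
  by (auto simp: A_L_def b_H_def b_L_def)

lemma A_H_bounds: "0 < A_H M m p" "A_H M m p < 1"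
  using convex_unit_less[of "b_L M m p" "b_H M m p" q] params logistic_bounds
  by (auto simp: A_H_def b_H_def b_L_def add.commute)

text \<open>Bayes' rule: \<open>A_bar\<close> mixes \<open>A_L\<close> and \<open>A_H\<close> with
  weights 1 - m and m, and the numerator is one of the two nonnegative terms.\<close>

lemma purchase_posterior_range:
  assumes "m \<in> {0..1}"
  shows "purchase_posterior M m p \<in> {0..1}"
proof -
  have A: "A_bar M m p = (1 - m) * A_L M m p + m * A_H M m p"
    by (simp add: A_bar_def D0_def algebra_simps)
  have "A_bar M m p > 0"
    unfolding A using assms A_L_bounds A_H_bounds by (intro convex_unit_less) auto
  moreover have "m * A_H M m p \<le> A_bar M m p" "0 \<le> m * A_H M m p"
    unfolding A using assms A_L_bounds[of m p] A_H_bounds[of m p] by auto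
  ultimately show ?thesis
    unfolding purchase_posterior_def by (auto simp: divide_simps)
qed

text \<open>Both denominators run between 1 - q and q, whose difference is
  \<open>informativeness M\<close>.\<close>

lemma posterior_denominators:
  assumes "l \<in> {0..1}"
  shows "(1 - q) + informativeness M * l \<noteq> 0" "q - informativeness M * l \<noteq> 0"
proof -
  let ?d = "informativeness M"
  have "?d > 0" "?d < q" using params by (auto simp: informativeness_def)
  then have "0 \<le> ?d * l" "?d * l \<le> ?d"
    using assms by (auto simp: mult_left_le)
  then show "(1 - q) + ?d * l \<noteq> 0" "q - ?d * l \<noteq> 0"
    using \<open>?d < q\<close> params by linarith+
qed

lemma continuous_on_A_L: "continuous_on {0..1} (\<lambda>x. A_L M x p)"
proof -
  have "1 + exp z \<noteq> 0" for z :: real using exp_gt_zero[of z] by linarith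
  then show ?thesis
    unfolding A_L_def b_H_def b_L_def pi_H_def pi_L_def logistic_def
    using posterior_denominators params by (auto intro!: continuous_intros)
qed

text \<open>Prepares the Lipschitz bound, for which any continuous derivative on the compact
  interval will do; hence the existential.\<close>

lemma DERIV_silence_drift:
  "\<exists>D. continuous_on {0..1} D \<and>
     (\<forall>l\<in>{0..1}. ((\<lambda>m. silence_drift M m p) has_real_derivative D l) (at l within {0..1}))"
proof -
  let ?d = "informativeness M"
  note nz = posterior_denominators
  \<comment> \<open>Derivatives of \<open>b_H\<close> and \<open>b_L\<close> in the belief. In the
    quotient rule for either posterior the terms in l cancel, leaving the numerator q (1 -
    q).\<close>
  define H where "H l = (quality_value M * (q * (1 - q)) / ((1 - q) + ?d * l)\<^sup>2) / logit_scale M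
    * (b_H M l p * (1 - b_H M l p))" for l
  define L where "L l = (quality_value M * (q * (1 - q)) / (q - ?d * l)\<^sup>2) / logit_scale M
    * (b_L M l p * (1 - b_L M l p))" for l
  have dH: "((\<lambda>l. b_H M l p) has_real_derivative H l) (at l)"
    and dL: "((\<lambda>l. b_L M l p) has_real_derivative L l) (at l)" if l: "l \<in> {0..1}" for l
  proof -
    have "(pi_H M has_real_derivative (q * ((1 - q) + ?d * l) - (q * l) * ?d) / (((1 - q) + ?d * l) * ((1 - q) + ?d * l))) (at l)"
      unfolding pi_H_def[abs_def] using nz[OF l]
      by (intro DERIV_divide) (auto intro!: derivative_eq_intros)
    moreover have "q * ((1 - q) + ?d * l) - (q * l) * ?d = q * (1 - q)"
      by (simp add: algebra_simps)
    ultimately have "(pi_H M has_real_derivative q * (1 - q) / ((1 - q) + ?d * l)\<^sup>2) (at l)"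
      by (simp only: power2_eq_square)
    then have "((\<lambda>l. (quality_value M * pi_H M l - p) / logit_scale M) has_real_derivative
        (quality_value M * (q * (1 - q) / ((1 - q) + ?d * l)\<^sup>2) - 0) / logit_scale M) (at l)"
      by (intro DERIV_cdivide DERIV_diff DERIV_cmult DERIV_const)
    from DERIV_chain2[OF DERIV_logistic this]
    show "((\<lambda>l. b_H M l p) has_real_derivative H l) (at l)"
      unfolding b_H_def[abs_def] H_def b_H_def by (simp add: mult_ac)
    have "(pi_L M has_real_derivative ((1 - q) * (q - ?d * l) - ((1 - q) * l) * (- ?d)) / ((q - ?d * l) * (q - ?d * l))) (at l)"
      unfolding pi_L_def[abs_def] using nz[OF l]
      by (intro DERIV_divide) (auto intro!: derivative_eq_intros)
    moreover have "(1 - q) * (q - ?d * l) - ((1 - q) * l) * (- ?d) = q * (1 - q)"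
      by (simp add: algebra_simps)
    ultimately have "(pi_L M has_real_derivative q * (1 - q) / (q - ?d * l)\<^sup>2) (at l)"
      by (simp only: power2_eq_square)
    then have "((\<lambda>l. (quality_value M * pi_L M l - p) / logit_scale M) has_real_derivative
        (quality_value M * (q * (1 - q) / (q - ?d * l)\<^sup>2) - 0) / logit_scale M) (at l)"
      by (intro DERIV_cdivide DERIV_diff DERIV_cmult DERIV_const)
    from DERIV_chain2[OF DERIV_logistic this]
    show "((\<lambda>l. b_L M l p) has_real_derivative L l) (at l)"
      unfolding b_L_def[abs_def] L_def b_L_def by (simp add: mult_ac)
  qed
  have bc: "continuous_on {0..1} (\<lambda>l. b_H M l p)" "continuous_on {0..1} (\<lambda>l. b_L M l p)"
    using dH dL by (meson DERIV_isCont continuous_at_imp_continuous_on)+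
  have Hc: "continuous_on {0..1} H" "continuous_on {0..1} L"
    unfolding H_def L_def using nz params by (auto intro!: continuous_intros bc)
  have D0: "D0 M l p = ?d * (b_H M l p - b_L M l p)" for l
    by (simp add: D0_def A_H_def A_L_def informativeness_def algebra_simps)
  define D where "D l = - \<nu> * (1 - 2 * l) * D0 M l p - \<nu> * l * (1 - l) * (?d * (H l - L l))" for l
  have "continuous_on {0..1} D"
    unfolding D_def D0 by (intro continuous_intros Hc bc)
  moreover have "((\<lambda>m. silence_drift M m p) has_real_derivative D l) (at l within {0..1})"
    if "l \<in> {0..1}" for l
  proof -
    have "((\<lambda>m. - \<nu> * m * (1 - m) * (?d * (b_H M m p - b_L M m p))) has_real_derivative D l) (at l)"
      unfolding D_def D0 by (rule derivative_eq_intros dH dL that refl)+ (simp add: algebra_simps)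
    then show ?thesis
      unfolding silence_drift_def D0 by (rule has_field_derivative_at_within)
  qed
  ultimately show ?thesis by blast
qed

section \<open>The silence flow: existence, uniqueness, joint continuity\<close>

lemma silence_drift_lipschitz: "\<exists>L. L-lipschitz_on {0..1} (\<lambda>m. silence_drift M m p)"
proof -
  obtain D where Dc: "continuous_on {0..1} D"
    and D: "\<And>l. l \<in> {0..1} \<Longrightarrow>
      ((\<lambda>m. silence_drift M m p) has_real_derivative D l) (at l within {0..1})"
    using DERIV_silence_drift by blast
  have "bounded (D ` {0..1})"
    using Dc by (intro compact_imp_bounded compact_continuous_image) auto
  then obtain L where L: "L > 0" "\<And>l. l \<in> {0..1} \<Longrightarrow> \<bar>D l\<bar> \<le> L"
    by (auto simp: bounded_pos)
  have "L-lipschitz_on {0..1} (\<lambda>m. silence_drift M m p)"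
  proof (rule lipschitz_onI)
    fix x y :: real assume "x \<in> {0..1}" "y \<in> {0..1}"
    then show "dist (silence_drift M x p) (silence_drift M y p) \<le> L * dist x y"
      unfolding dist_norm using D L
      by (intro field_differentiable_bound[where S="{0..1}" and f'=D]) auto
  qed (use L in simp)
  then show ?thesis by blast
qed

text \<open>Resolves the definite description in \<open>flow\<close>: \<open>restrict\<close> gives
  the extensional representative, and extensional solutions that agree at nonnegative times are
  equal.\<close>

lemma flow_solves:
  assumes "m \<in> {0..1}"
  shows "solves_ode_atLeast (\<lambda>x. silence_drift M x p) (flow M p m)"
    and "flow M p m 0 = m" and "\<And>t. t \<ge> 0 \<Longrightarrow> flow M p m t \<in> {0..1}"
proof -
  let ?F = "\<lambda>x. silence_drift M x p"
  let ?P = "\<lambda>x. x \<in> {0..} \<rightarrow>\<^sub>E {0..1} \<and> x 0 = m \<and>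
     (\<forall>t\<ge>0. (x has_real_derivative silence_drift M (x t) p) (at t within {0..}))"
  obtain L where L: "L-lipschitz_on {0..1} ?F"
    using silence_drift_lipschitz by blast
  obtain x where x: "solves_ode_atLeast ?F x" "x 0 = m" "\<forall>t\<ge>0. x t \<in> {0..1}"
    using solves_ode_unit_interval_exists[OF L _ _ assms] by (auto simp: silence_drift_def)
  have ex: "?P (restrict x {0..})"
  proof (intro conjI allI impI)
    fix t :: real assume t: "t \<ge> 0"
    have "(x has_real_derivative ?F (x t)) (at t within {0..})"
      using x(1) t unfolding solves_ode_atLeast_def by blast
    then have "(restrict x {0..} has_real_derivative ?F (x t)) (at t within {0..})"
      by (rule has_field_derivative_transform_within[where d=1]) (use t in auto)
    then show "(restrict x {0..} has_real_derivative ?F (restrict x {0..} t)) (at t within {0..})"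
      using t by simp
  qed (use x in auto)
  have un: "y = z" if "?P y" "?P z" for y z
  proof (rule PiE_ext)
    show "y \<in> {0..} \<rightarrow>\<^sub>E {0..1}" "z \<in> {0..} \<rightarrow>\<^sub>E {0..1}" using that by blast+
    have yz: "solves_ode_atLeast ?F y" "solves_ode_atLeast ?F z" "y 0 = z 0"
      using that unfolding solves_ode_atLeast_def by simp_all
    have range: "y s \<in> {0..1}" "z s \<in> {0..1}" if "s \<ge> 0" for s
      using \<open>?P y\<close> \<open>?P z\<close> that by (auto dest!: PiE_mem[of _ "{0..}" _ s])
    show "y t = z t" if "t \<in> {0..}" for t
      by (rule solves_ode_atLeast_unique[OF L yz(1) range(1) yz(2) range(2) yz(3)]) (use that in auto)
  qed
  have "\<exists>!x. ?P x"
    by (rule ex1I[of ?P, OF ex]) (rule un[OF _ ex])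
  then have P: "?P (flow M p m)"
    unfolding flow_def by (rule theI')
  show "solves_ode_atLeast ?F (flow M p m)"
    unfolding solves_ode_atLeast_def using P by (elim conjE)
  show "flow M p m 0 = m"
    using P by (elim conjE)
  have "flow M p m \<in> {0..} \<rightarrow>\<^sub>E {0..1}"
    using P by (elim conjE)
  then show "flow M p m t \<in> {0..1}" if "t \<ge> 0" for t
    by (rule PiE_mem) (use that in simp)
qed

text \<open>Continuity in time for each belief, together with a Lipschitz constant in the belief
  that is uniform over nearby times, gives joint continuity.\<close>

lemma continuous_on_flow: "continuous_on ({0..} \<times> {0..1}) (\<lambda>(t, m). flow M p m t)"
proof (rule Lipschitz.continuous_on_TimesI)
  obtain L where L: "L-lipschitz_on {0..1} (\<lambda>x. silence_drift M x p)"
    using silence_drift_lipschitz by blast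
  have "L \<ge> 0" using L by (rule lipschitz_on_nonneg)
  show "local_lipschitz {0..} {0..1} (\<lambda>t m. flow M p m t)"
  proof (rule local_lipschitzI)
    fix t m :: real assume "t \<in> {0..}" "m \<in> {0..1}"
    \<comment> \<open>Times within distance 1 of t are at most t + 1, so this dominates
      \<open>exp (L * s)\<close>.\<close>
    define K where "K = exp (L * (t + 1))"
    have "K-lipschitz_on (cball m 1 \<inter> {0..1}) (\<lambda>m. flow M p m s)"
      if "s \<in> cball t 1 \<inter> {0..}" for s
    proof (rule lipschitz_onI)
      fix x y assume xy: "x \<in> cball m 1 \<inter> {0..1}" "y \<in> cball m 1 \<inter> {0..1}"
      have "\<bar>flow M p x s - flow M p y s\<bar> \<le> exp (L * s) * \<bar>flow M p x 0 - flow M p y 0\<bar>"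
        using xy that by (intro solves_ode_atLeast_dist[OF L] flow_solves) auto
      also have "\<dots> \<le> K * \<bar>x - y\<bar>"
        using that \<open>L \<ge> 0\<close> xy
        by (auto simp: K_def flow_solves dist_real_def intro!: mult_right_mono mult_left_mono)
      finally show "dist (flow M p x s) (flow M p y s) \<le> K * dist x y"
        by (simp add: dist_real_def)
    qed (simp add: K_def)
    then show "\<exists>u>0. \<exists>L. \<forall>s\<in>cball t u \<inter> {0..}. L-lipschitz_on (cball m u \<inter> {0..1}) (\<lambda>m. flow M p m s)"
      by (intro exI[of _ 1] conjI exI[of _ K]) auto
  qed
next
  fix m :: real assume "m \<in> {0..1}"
  then show "continuous_on {0..} (flow M p m)"
    by (rule solves_ode_atLeast_continuous[OF flow_solves(1)])
qed

subsection \<open>The strategic operator\<close>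

text \<open>The first component is the belief, the second the time; clamping both stays inside the
  region of joint continuity.\<close>

lemma borel_measurable_flow [measurable]:
  "(\<lambda>x. flow M p (unit_clamp (fst x)) (max 0 (snd x))) \<in> borel_measurable (borel \<Otimes>\<^sub>M borel)"
proof -
  have "continuous_on UNIV (\<lambda>x. case (max 0 (snd x), unit_clamp (fst x)) of (t, m) \<Rightarrow> flow M p m t)"
  proof (rule continuous_on_compose2[OF continuous_on_flow])
    show "continuous_on UNIV (\<lambda>x :: real \<times> real. (max 0 (snd x), unit_clamp (fst x)))"
      unfolding unit_clamp_def by (intro continuous_intros)
  qed auto
  then show ?thesis
    unfolding borel_prod prod.case by (rule borel_measurable_continuous_onI)
qed

lemma borel_measurable_survival:
  assumes [measurable]: "(\<lambda>x. A x p) \<in> borel_measurable borel"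
  shows "(\<lambda>x. survival M A (unit_clamp (fst x)) p (max 0 (snd x))) \<in> borel_measurable (borel \<Otimes>\<^sub>M borel)"
proof -
  define h where "h m s = \<kappa> + \<nu> * A (flow M p (unit_clamp m) (max 0 s)) p" for m s
  have [measurable]: "(\<lambda>x. h (fst x) (snd x)) \<in> borel_measurable (borel \<Otimes>\<^sub>M borel)"
    unfolding h_def by measurable
  \<comment> \<open>The variable upper limit moves into the integrand, leaving an integral over the
    whole line that depends on a parameter.\<close>
  have "(\<lambda>(x, s). (if 0 \<le> s \<and> s \<le> max 0 (snd x) then h (fst x) s else 0))
    \<in> borel_measurable ((borel \<Otimes>\<^sub>M borel) \<Otimes>\<^sub>M lborel)"
  proof -
    have "(\<lambda>y. h (fst (fst y)) (snd y)) \<in> borel_measurable ((borel \<Otimes>\<^sub>M borel) \<Otimes>\<^sub>M lborel)"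
      by (rule measurable_compose[of "\<lambda>y. (fst (fst y), snd y)" _ "borel \<Otimes>\<^sub>M borel" "\<lambda>x. h (fst x) (snd x)", simplified])
        measurable
    then show ?thesis
      unfolding split_beta' by measurable
  qed
  then have "(\<lambda>x. \<integral>s. (if 0 \<le> s \<and> s \<le> max 0 (snd x) then h (fst x) s else 0) \<partial>lborel)
    \<in> borel_measurable (borel \<Otimes>\<^sub>M borel)"
    by (rule lborel.borel_measurable_lebesgue_integral)
  then have "(\<lambda>x. exp (- (\<integral>s. (if 0 \<le> s \<and> s \<le> max 0 (snd x) then h (fst x) s else 0) \<partial>lborel)))
    \<in> borel_measurable (borel \<Otimes>\<^sub>M borel)"
    by measurable
  also have "(\<lambda>x. exp (- (\<integral>s. (if 0 \<le> s \<and> s \<le> max 0 (snd x) then h (fst x) s else 0) \<partial>lborel))) =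
    (\<lambda>x. survival M A (unit_clamp (fst x)) p (max 0 (snd x)))"
    unfolding survival_def set_lebesgue_integral_def
    by (intro ext arg_cong[where f="\<lambda>x. exp (- x)"] Bochner_Integration.integral_cong)
      (auto simp: indicator_def h_def)
  finally show ?thesis .
qed

definition discount :: "real \<Rightarrow> real \<Rightarrow> real \<Rightarrow> real" where
  "discount p m t = exp (- \<rho> * t) * survival M (A_L M) m p t"

definition hazard :: "real \<Rightarrow> real \<Rightarrow> real \<Rightarrow> real" where
  "hazard p m t = \<kappa> + \<nu> * A_L M (flow M p m t) p"

text \<open>Payoffs already multiplied by their event rates, so that the result is comparable with
  \<open>hazard\<close>, the sum of those rates.\<close>

definition event_payoff :: "selector \<Rightarrow> (real \<times> real \<Rightarrow> real) \<Rightarrow> real \<Rightarrow> real \<Rightarrow> real" where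
  "event_payoff r f p x = \<nu> * p * A_L M x p
     + \<kappa> * (\<Sum>p'\<in>price_menu M. pmf (r (x, p)) p' * f (x, p'))
     + \<nu> * A_L M x p * f (purchase_posterior M x p, p)"

text \<open>The bound R / (\<rho> + R) at R = \<kappa> + \<nu>, the contraction factor of the
  strategic operator.\<close>

definition modulus :: real where
  "modulus = (\<kappa> + \<nu>) / (\<rho> + (\<kappa> + \<nu>))"

lemma modulus: "0 \<le> modulus" "modulus < 1"
  using params by (auto simp: modulus_def)

lemma strategic_operator_eq:
  "strategic_operator M r f (m, p) =
     (LBINT t:{0..}. discount p m t * event_payoff r f p (flow M p m t))"
  by (simp add: strategic_operator_def discount_def event_payoff_def Let_def)

section \<open>Estimates for the discounted event payoff\<close>

lemma discount_hazard:
  assumes "m \<in> {0..1}"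
  shows "set_integrable lborel {0..} (\<lambda>t. discount p m t * hazard p m t)"
    and "(LBINT t:{0..}. discount p m t * hazard p m t) \<le> modulus"
proof -
  have c: "continuous_on {0..} (hazard p m)"
    unfolding hazard_def[abs_def]
    by (intro continuous_intros continuous_on_compose2[OF continuous_on_A_L]
        solves_ode_atLeast_continuous[OF flow_solves(1)[OF assms]])
      (use flow_solves(3)[OF assms] in auto)
  have h: "0 \<le> hazard p m t" "hazard p m t \<le> \<kappa> + \<nu>" for t
    using params A_L_bounds[of "flow M p m t" p] by (auto simp: hazard_def mult_left_le)
  have d: "discount p m t = exp (- \<rho> * t) * exp (- (LBINT s:{0..t}. hazard p m s))" for t
    by (simp add: discount_def survival_def hazard_def)
  show "set_integrable lborel {0..} (\<lambda>t. discount p m t * hazard p m t)"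
    "(LBINT t:{0..}. discount p m t * hazard p m t) \<le> modulus"
    unfolding d modulus_def using discounted_hazard_integral[OF c h params(1)] by auto
qed

lemma discount_nonneg: "discount p m t \<ge> 0"
  by (simp add: discount_def survival_def)

text \<open>Maximisers lie in the menu, so the support does too.\<close>

lemma exact_selector_sum:
  assumes "exact_selector M r" "m \<in> {0..1}" "p \<in> price_menu M"
  shows "(\<Sum>p'\<in>price_menu M. pmf (r (m, p)) p') = 1"
  using assms params
  by (intro sum_pmf_eq_1) (fastforce simp: exact_selector_def optimal_prices_def is_arg_max_def)+

lemma posterior_in_states:
  assumes "x \<in> {0..1}" "p \<in> price_menu M"
  shows "(purchase_posterior M x p, p) \<in> states M"
  using assms purchase_posterior_range by (simp add: states_def)

text \<open>Price receipts cancel. The reset term differs by an average and the purchase term by a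
  single value, so the two rates add up to the hazard.\<close>

lemma event_payoff_diff:
  assumes r: "exact_selector M r" and x: "x \<in> {0..1}" and p: "p \<in> price_menu M"
    and \<delta>: "\<forall>y\<in>states M. \<bar>f y - g y\<bar> \<le> \<delta>"
  shows "\<bar>event_payoff r f p x - event_payoff r g p x\<bar> \<le> (\<kappa> + \<nu> * A_L M x p) * \<delta>"
proof -
  let ?a = "\<Sum>p'\<in>price_menu M. pmf (r (x, p)) p' * (f (x, p') - g (x, p'))"
  let ?J = "(purchase_posterior M x p, p)"
  have "\<bar>?a\<bar> \<le> (\<Sum>p'\<in>price_menu M. pmf (r (x, p)) p' * \<delta>)"
    by (rule order_trans[OF sum_abs sum_mono])
      (use \<delta> x in \<open>auto simp: abs_mult states_def intro!: mult_left_mono\<close>)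
  also have "\<dots> = \<delta>"
    using exact_selector_sum[OF r x p] by (simp flip: sum_distrib_right)
  finally have "\<kappa> * \<bar>?a\<bar> \<le> \<kappa> * \<delta>"
    using params by (intro mult_left_mono) auto
  moreover have "\<nu> * A_L M x p * \<bar>f ?J - g ?J\<bar> \<le> \<nu> * A_L M x p * \<delta>"
    using \<delta> posterior_in_states[OF x p] params A_L_bounds[of x p] by (intro mult_left_mono) auto
  moreover have "event_payoff r f p x - event_payoff r g p x = \<kappa> * ?a + \<nu> * A_L M x p * (f ?J - g ?J)"
    by (simp add: event_payoff_def algebra_simps sum_subtractf sum_distrib_left)
  moreover have "\<bar>\<kappa> * ?a + \<nu> * A_L M x p * (f ?J - g ?J)\<bar>
      \<le> \<kappa> * \<bar>?a\<bar> + \<nu> * A_L M x p * \<bar>f ?J - g ?J\<bar>"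
    using params A_L_bounds[of x p]
    by (intro order_trans[OF abs_triangle_ineq]) (simp add: abs_mult)
  ultimately show ?thesis
    by (simp add: distrib_right)
qed

text \<open>Comparison with zero continuation values leaves the receipts; enlarging these by
  \<kappa> p makes the hazard a common factor.\<close>

lemma event_payoff_bound:
  assumes r: "exact_selector M r" and x: "x \<in> {0..1}" and p: "p \<in> price_menu M"
    and C: "\<forall>y\<in>states M. \<bar>f y\<bar> \<le> C"
  shows "\<bar>event_payoff r f p x\<bar> \<le> (\<kappa> + \<nu> * A_L M x p) * (p + C)"
proof -
  have "\<bar>event_payoff r f p x - event_payoff r (\<lambda>_. 0) p x\<bar> \<le> (\<kappa> + \<nu> * A_L M x p) * C"
    using C by (intro event_payoff_diff[OF r x p]) simp
  moreover have "event_payoff r (\<lambda>_. 0) p x = \<nu> * A_L M x p * p"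
    by (simp add: event_payoff_def)
  moreover have "0 \<le> \<nu> * A_L M x p * p" "0 \<le> \<kappa> * p"
    using params(2,3) params(10)[OF p] A_L_bounds(1)[of x p] by simp_all
  ultimately have "\<bar>event_payoff r f p x\<bar> \<le> (\<kappa> + \<nu> * A_L M x p) * C + (\<nu> * A_L M x p * p + \<kappa> * p)"
    by linarith
  then show ?thesis
    by (simp add: algebra_simps)
qed

lemma borel_measurable_event_payoff:
  assumes r: "exact_selector M r" and f: "f \<in> bounded_borel M" and p: "p \<in> price_menu M"
  shows "(\<lambda>x. event_payoff r f p (unit_clamp x)) \<in> borel_measurable borel"
proof -
  have [measurable]: "(\<lambda>x. pmf (r (unit_clamp x, p)) p') \<in> borel_measurable borel"
    "(\<lambda>x. f (unit_clamp x, p')) \<in> borel_measurable borel" if "p' \<in> price_menu M" for p'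
    using r f p that
    unfolding exact_selector_def bounded_borel_def borel_measurable_restrict_unit_iff by blast+
  \<comment> \<open>The posterior of a clamped belief is already in [0, 1]; the second clamp is
    inserted to compose with the total version of \<open>f\<close> and then removed.\<close>
  have "(\<lambda>x. f (unit_clamp (purchase_posterior M (unit_clamp x) p), p)) \<in> borel_measurable borel"
    by (rule measurable_compose[of "\<lambda>x. purchase_posterior M (unit_clamp x) p" _ borel "\<lambda>x. f (unit_clamp x, p)"])
      (use p in measurable)
  also have "(\<lambda>x. f (unit_clamp (purchase_posterior M (unit_clamp x) p), p)) =
      (\<lambda>x. f (purchase_posterior M (unit_clamp x) p, p))"
    using purchase_posterior_range by (simp add: unit_clamp_id)
  finally have [measurable]: "(\<lambda>x. f (purchase_posterior M (unit_clamp x) p, p)) \<in> borel_measurable borel" .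
  show ?thesis
    unfolding event_payoff_def by measurable
qed

lemma borel_measurable_integrand:
  assumes r: "exact_selector M r" and f: "f \<in> bounded_borel M" and p: "p \<in> price_menu M"
  shows "(\<lambda>x. indicator {0..} (snd x) *\<^sub>R (discount p (unit_clamp (fst x)) (snd x) *
      event_payoff r f p (flow M p (unit_clamp (fst x)) (snd x)))) \<in> borel_measurable (borel \<Otimes>\<^sub>M borel)"
proof -
  note [measurable] = measurable_compose[OF borel_measurable_flow[of p] borel_measurable_event_payoff[OF r f p]]
    borel_measurable_survival[of "A_L M" p, OF borel_measurable_model(1)]
  have "(\<lambda>x. indicator {0..} (snd x) *\<^sub>R (exp (- \<rho> * snd x)
      * survival M (A_L M) (unit_clamp (fst x)) p (max 0 (snd x))
      * event_payoff r f p (unit_clamp (flow M p (unit_clamp (fst x)) (max 0 (snd x))))))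
      \<in> borel_measurable (borel \<Otimes>\<^sub>M (borel :: real measure))" (is "?lhs \<in> _")
    by (intro borel_measurable_scaleR borel_measurable_times) measurable
  also have "?lhs =
    (\<lambda>x. indicator {0..} (snd x) *\<^sub>R (discount p (unit_clamp (fst x)) (snd x) *
      event_payoff r f p (flow M p (unit_clamp (fst x)) (snd x))))" (is "_ = ?rhs")
  proof (rule ext)
    fix x :: "real \<times> real"
    have "unit_clamp (flow M p (unit_clamp (fst x)) (snd x)) = flow M p (unit_clamp (fst x)) (snd x)"
      if "snd x \<ge> 0"
      using that by (intro unit_clamp_id flow_solves(3)) auto
    then show "?lhs x = ?rhs x"
      by (simp add: indicator_def discount_def max_absorb2)
  qed
  finally show ?thesis .
qed

lemma borel_measurable_integrand_at:
  assumes "exact_selector M r" "f \<in> bounded_borel M" "p \<in> price_menu M" "m \<in> {0..1}"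
  shows "(\<lambda>t. indicator {0..} t *\<^sub>R (discount p m t * event_payoff r f p (flow M p m t)))
    \<in> borel_measurable lborel"
proof -
  have "(\<lambda>t. (m, t)) \<in> borel \<rightarrow>\<^sub>M borel \<Otimes>\<^sub>M borel" by measurable
  from measurable_compose[OF this borel_measurable_integrand[OF assms(1-3)]]
  show ?thesis
    by (simp add: unit_clamp_id[OF \<open>m \<in> {0..1}\<close>])
qed

text \<open>Source of both the boundedness of the operator and its contraction:
  \<open>discount\<close> times \<open>hazard\<close> is the dominating function, with mass at most
  \<open>modulus\<close>.\<close>

lemma discounted_integral_bound:
  assumes m: "m \<in> {0..1}" and "C \<ge> 0"
    and meas: "(\<lambda>t. indicator {0..} t *\<^sub>R (discount p m t * k t)) \<in> borel_measurable lborel"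
    and bound: "\<And>t. t \<ge> 0 \<Longrightarrow> \<bar>k t\<bar> \<le> hazard p m t * C"
  shows "set_integrable lborel {0..} (\<lambda>t. discount p m t * k t)"
    and "\<bar>LBINT t:{0..}. discount p m t * k t\<bar> \<le> modulus * C"
proof -
  let ?H = "\<lambda>t. discount p m t * hazard p m t"
  have H: "integrable lborel (\<lambda>t. indicator {0..} t *\<^sub>R ?H t * C)"
    using discount_hazard(1)[OF m] unfolding set_integrable_def by (rule integrable_mult_left)
  have le: "norm (indicator {0..} t *\<^sub>R (discount p m t * k t)) \<le> indicator {0..} t *\<^sub>R ?H t * C" for t
  proof (cases "t \<ge> 0")
    case True
    have "discount p m t * \<bar>k t\<bar> \<le> discount p m t * (hazard p m t * C)"
      using bound[OF True] discount_nonneg by (rule mult_left_mono)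
    then show ?thesis
      using True discount_nonneg[of p m t] by (simp add: abs_mult mult.assoc)
  qed simp
  have int: "integrable lborel (\<lambda>t. indicator {0..} t *\<^sub>R (discount p m t * k t))"
    by (rule Bochner_Integration.integrable_bound[OF H meas])
      (use le in \<open>auto intro: order_trans[OF _ abs_ge_self]\<close>)
  then show "set_integrable lborel {0..} (\<lambda>t. discount p m t * k t)"
    by (simp add: set_integrable_def)
  have "\<bar>LBINT t:{0..}. discount p m t * k t\<bar> \<le> (\<integral>t. indicator {0..} t *\<^sub>R ?H t * C \<partial>lborel)"
    unfolding set_lebesgue_integral_def real_norm_def[symmetric]
    using int H le by (rule Bochner_Integration.integral_norm_bound_integral)
  also have "\<dots> = (LBINT t:{0..}. ?H t) * C"
    unfolding set_lebesgue_integral_def by (rule integral_mult_left_zero)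
  also have "\<dots> \<le> modulus * C"
    using discount_hazard(2)[OF m] \<open>C \<ge> 0\<close> by (rule mult_right_mono)
  finally show "\<bar>LBINT t:{0..}. discount p m t * k t\<bar> \<le> modulus * C" .
qed

lemma strategic_operator_bound:
  assumes r: "exact_selector M r" and f: "f \<in> bounded_borel M"
    and p: "p \<in> price_menu M" and m: "m \<in> {0..1}" and C: "\<forall>y\<in>states M. \<bar>f y\<bar> \<le> C"
  shows "set_integrable lborel {0..} (\<lambda>t. discount p m t * event_payoff r f p (flow M p m t))"
    and "\<bar>strategic_operator M r f (m, p)\<bar> \<le> modulus * (p + C)"
proof -
  have "\<bar>f (m, p)\<bar> \<le> C" using C m p by (simp add: states_def)
  then have pC: "p + C \<ge> 0" using params(10)[OF p] by linarith
  have bound: "\<bar>event_payoff r f p (flow M p m t)\<bar> \<le> hazard p m t * (p + C)" if "t \<ge> 0" for t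
    unfolding hazard_def by (intro event_payoff_bound r p C flow_solves m that)
  show "set_integrable lborel {0..} (\<lambda>t. discount p m t * event_payoff r f p (flow M p m t))"
    "\<bar>strategic_operator M r f (m, p)\<bar> \<le> modulus * (p + C)"
    unfolding strategic_operator_eq
    using discounted_integral_bound[OF m pC borel_measurable_integrand_at[OF r f p m] bound] by simp_all
qed

lemma strategic_operator_diff:
  assumes r: "exact_selector M r" and f: "f \<in> bounded_borel M" and g: "g \<in> bounded_borel M"
    and \<delta>: "\<forall>y\<in>states M. \<bar>f y - g y\<bar> \<le> \<delta>" and x: "x \<in> states M"
  shows "\<bar>strategic_operator M r f x - strategic_operator M r g x\<bar> \<le> modulus * \<delta>"
proof -
  obtain m p where mp: "x = (m, p)" "m \<in> {0..1}" "p \<in> price_menu M"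
    using x by (auto simp: states_def)
  have "\<delta> \<ge> 0" using bspec[OF \<delta> x] by linarith
  let ?k = "\<lambda>h t. event_payoff r h p (flow M p m t)"
  have int: "set_integrable lborel {0..} (\<lambda>t. discount p m t * ?k h t)" if h: "h \<in> bounded_borel M" for h
  proof -
    obtain C where "\<forall>y\<in>states M. \<bar>h y\<bar> \<le> C"
      using h by (auto simp: bounded_borel_def bounded_iff)
    then show ?thesis
      by (rule strategic_operator_bound(1)[OF r h mp(3,2)])
  qed
  have "strategic_operator M r f x - strategic_operator M r g x
      = (LBINT t:{0..}. discount p m t * (?k f t - ?k g t))"
    using set_integral_diff(2)[OF int[OF f] int[OF g]]
    by (simp add: mp strategic_operator_eq right_diff_distrib)
  moreover have "\<bar>?k f t - ?k g t\<bar> \<le> hazard p m t * \<delta>" if "t \<ge> 0" for t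
    unfolding hazard_def using that mp by (intro event_payoff_diff r \<delta> flow_solves)
  moreover have "(\<lambda>t. indicator {0..} t *\<^sub>R (discount p m t * (?k f t - ?k g t))) \<in> borel_measurable lborel"
    using borel_measurable_diff[OF borel_measurable_integrand_at[OF r f mp(3,2)]
        borel_measurable_integrand_at[OF r g mp(3,2)]]
    by (simp only: right_diff_distrib scaleR_diff_right)
  ultimately show ?thesis
    using discounted_integral_bound(2)[OF mp(2) \<open>\<delta> \<ge> 0\<close>] by simp
qed

section \<open>The strategic value as the fixed point of a contraction\<close>

lemma zero_bounded_borel: "(\<lambda>x\<in>states M. 0) \<in> bounded_borel M"
proof -
  have "(\<lambda>m. (\<lambda>x\<in>states M. 0 :: real) (m, p)) \<in> borel_measurable (restrict_space borel {0..1})"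
    if "p \<in> price_menu M" for p
    unfolding borel_measurable_restrict_unit_iff using that by (simp add: states_def)
  then show ?thesis by (auto simp: bounded_borel_def bounded_iff)
qed

lemma strategic_operator_bounded_borel:
  assumes r: "exact_selector M r" and f: "f \<in> bounded_borel M"
  shows "restrict (strategic_operator M r f) (states M) \<in> bounded_borel M"
proof -
  have meas: "(\<lambda>m. restrict (strategic_operator M r f) (states M) (m, p))
      \<in> borel_measurable (restrict_space borel {0..1})" if p: "p \<in> price_menu M" for p
  proof -
    have "(\<lambda>m. \<integral>t. indicator {0..} t *\<^sub>R (discount p (unit_clamp m) t *
        event_payoff r f p (flow M p (unit_clamp m) t)) \<partial>lborel) \<in> borel_measurable borel"
      using borel_measurable_integrand[OF r f p]
      by (intro lborel.borel_measurable_lebesgue_integral) (simp add: split_beta' measurable_lborel2 cong: measurable_cong_sets)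
    then show ?thesis
      unfolding borel_measurable_restrict_unit_iff using p
      by (simp add: states_def strategic_operator_eq set_lebesgue_integral_def)
  qed
  obtain C where C: "\<forall>y\<in>states M. \<bar>f y\<bar> \<le> C"
    using f by (auto simp: bounded_borel_def bounded_iff)
  have "\<bar>strategic_operator M r f x\<bar> \<le> modulus * (Max (price_menu M) + C)" if x: "x \<in> states M" for x
  proof -
    obtain m p where mp: "x = (m, p)" "m \<in> {0..1}" "p \<in> price_menu M"
      using x by (auto simp: states_def)
    have "\<bar>strategic_operator M r f x\<bar> \<le> modulus * (p + C)"
      unfolding mp by (rule strategic_operator_bound(2)[OF r f mp(3,2) C])
    also have "\<dots> \<le> modulus * (Max (price_menu M) + C)"
      using mp params modulus by (intro mult_left_mono) auto
    finally show ?thesis .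
  qed
  then have "bounded (restrict (strategic_operator M r f) (states M) ` states M)"
    unfolding bounded_iff by (intro exI[of _ "modulus * (Max (price_menu M) + C)"]) auto
  with meas show ?thesis
    by (simp add: bounded_borel_def)
qed

lemma bounded_borel_uniform_limit:
  assumes s: "\<And>n. s n \<in> bounded_borel M" and ul: "uniform_limit (states M) s g sequentially"
  shows "restrict g (states M) \<in> bounded_borel M"
proof -
  obtain N where N: "\<forall>x\<in>states M. dist (s N x) (g x) < 1"
    using uniform_limitD[OF ul, of 1] by (auto simp: eventually_sequentially)
  obtain C where C: "\<forall>x\<in>states M. \<bar>s N x\<bar> \<le> C"
    using s[of N] by (auto simp: bounded_borel_def bounded_iff)
  have "\<bar>g x\<bar> \<le> C + 1" if "x \<in> states M" for x
    using bspec[OF N that] bspec[OF C that] by (simp add: dist_real_def)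
  then have "bounded (restrict g (states M) ` states M)"
    unfolding bounded_iff by (intro exI[of _ "C + 1"]) auto
  moreover have "(\<lambda>m. restrict g (states M) (m, p)) \<in> borel_measurable (restrict_space borel {0..1})"
    if p: "p \<in> price_menu M" for p
  proof (rule borel_measurable_LIMSEQ_real)
    show "(\<lambda>m. s n (m, p)) \<in> borel_measurable (restrict_space borel {0..1})" for n
      using s[of n] p by (auto simp: bounded_borel_def)
    show "(\<lambda>n. s n (m, p)) \<longlonglongrightarrow> restrict g (states M) (m, p)"
      if "m \<in> space (restrict_space borel {0..1})" for m
      using that p tendsto_uniform_limitI[OF ul, of "(m, p)"]
      by (auto simp: states_def space_restrict_space)
  qed
  ultimately show ?thesis by (simp add: bounded_borel_def)
qed

lemma strategic_value_bounded_borel: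
  assumes r: "exact_selector M r"
  shows "strategic_value M r \<in> bounded_borel M"
proof -
  have "\<exists>!f. f \<in> bounded_borel M \<and> (\<forall>x\<in>states M. f x = strategic_operator M r f x)"
  proof (rule sup_norm_contraction_fixed_point[OF zero_bounded_borel _ _ strategic_operator_diff[OF r] modulus])
    fix f assume f: "f \<in> bounded_borel M"
    show "\<exists>g\<in>bounded_borel M. \<forall>x\<in>states M. g x = strategic_operator M r f x"
      using strategic_operator_bounded_borel[OF r f]
      by (intro bexI[of _ "restrict (strategic_operator M r f) (states M)"]) auto
  next
    fix f g assume "f \<in> bounded_borel M" "g \<in> bounded_borel M"
    then obtain C D where "\<forall>x\<in>states M. \<bar>f x\<bar> \<le> C" "\<forall>x\<in>states M. \<bar>g x\<bar> \<le> D"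
      by (auto simp: bounded_borel_def bounded_iff)
    then show "\<exists>\<delta>. \<forall>x\<in>states M. \<bar>f x - g x\<bar> \<le> \<delta>"
      by (intro exI[of _ "C + D"]) (fastforce simp: abs_le_iff)
  next
    fix s g assume "\<And>n. s n \<in> bounded_borel M" "uniform_limit (states M) s g sequentially"
    then show "\<exists>g'\<in>bounded_borel M. \<forall>x\<in>states M. g' x = g x"
      using bounded_borel_uniform_limit[of s g] by (intro bexI[of _ "restrict g (states M)"]) auto
  next
    fix f g :: "real \<times> real \<Rightarrow> real"
    assume "f \<in> bounded_borel M" "g \<in> bounded_borel M" "\<forall>x\<in>states M. f x = g x"
    then show "f = g"
      by (auto simp: bounded_borel_def intro: extensionalityI)
  qed
  from theI'[OF this] show ?thesis by (simp add: strategic_value_def)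
qed

subsection \<open>The cost threshold\<close>

text \<open>Makes \<open>cost_threshold\<close> a true least upper bound. The factor
  \<open>D0\<close> is a difference of two probabilities, and the strategic value is
  bounded.\<close>

lemma gross_gain_bdd_above:
  assumes r: "exact_selector M r"
  shows "bdd_above ((\<lambda>(m, p). gross_gain M r m p) ` states M)"
proof -
  obtain C where C: "\<forall>x\<in>states M. \<bar>strategic_value M r x\<bar> \<le> C"
    using strategic_value_bounded_borel[OF r] by (auto simp: bounded_borel_def bounded_iff)
  have "gross_gain M r m p \<le> Max (price_menu M) + 2 * C" if "(m, p) \<in> states M" for m p
  proof -
    have mp: "m \<in> {0..1}" "p \<in> price_menu M" using that by (auto simp: states_def)
    let ?w = "p + strategic_value M r (purchase_posterior M m p, p) - strategic_value M r (m, p)"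
    have "\<bar>?w\<bar> \<le> p + 2 * C"
      using C[rule_format, OF that] C[rule_format, OF posterior_in_states[OF mp]] params(10)[OF mp(2)]
      by linarith
    moreover have "\<bar>D0 M m p\<bar> \<le> 1"
      using A_H_bounds[of m p] A_L_bounds[of m p] unfolding D0_def by linarith
    ultimately have "\<bar>D0 M m p\<bar> * \<bar>?w\<bar> \<le> 1 * (p + 2 * C)"
      by (intro mult_mono) auto
    moreover have "gross_gain M r m p \<le> \<bar>D0 M m p\<bar> * \<bar>?w\<bar>"
      unfolding gross_gain_def by (metis abs_ge_self abs_mult)
    ultimately have "gross_gain M r m p \<le> 1 * (p + 2 * C)"
      by (rule order_trans[rotated])
    moreover have "p \<le> Max (price_menu M)" using mp params by simp
    ultimately show ?thesis by simp
  qed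
  then show ?thesis by (intro bdd_aboveI2) auto
qed

section \<open>One-shot deviations and the threshold\<close>

lemma sequentially_rational_iff_gain:
  "sequentially_rational M c r \<longleftrightarrow> (\<forall>(m, p)\<in>states M. gross_gain M r m p \<le> c)"
proof -
  have "opportunity_payoff M r m p (A_H M m p) - opportunity_payoff M r m p (A_L M m p) = gross_gain M r m p"
    for m p
    by (simp add: opportunity_payoff_def gross_gain_def D0_def algebra_simps)
  then have "profitable_switch M c r m p \<longleftrightarrow> \<not> gross_gain M r m p \<le> c" for m p
    unfolding profitable_switch_def by (smt (verit))
  then show ?thesis
    unfolding sequentially_rational_def by auto
qed

lemma states_nonempty: "states M \<noteq> {}"
  using params by (auto simp: states_def)

text \<open>A gain equal to c is not strictly profitable, so the condition is a weak inequality at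
  every state; it passes to the supremum whether or not that is attained.\<close>

lemma sequentially_rational_iff_threshold:
  assumes "exact_selector M r"
  shows "sequentially_rational M c r \<longleftrightarrow> c \<ge> cost_threshold M r"
  unfolding sequentially_rational_iff_gain cost_threshold_def
  using cSUP_le_iff[OF states_nonempty gross_gain_bdd_above[OF assms]] by (simp add: split_beta')

lemma gross_gain_le_threshold:
  assumes "exact_selector M r" "(m, p) \<in> states M"
  shows "gross_gain M r m p \<le> cost_threshold M r"
  unfolding cost_threshold_def
  using cSUP_upper[OF assms(2) gross_gain_bdd_above[OF assms(1)]] by simp

text \<open>The zeroth term of the expected number of resets in \<open>N\<close> is already a positively weighted
  integral of the time the silence path spends in \<open>N\<close>.\<close>

lemma event_time_null_flow:
  assumes null: "event_time_null M A r N" and m: "m \<in> {0..1}" and p: "p \<in> price_menu M"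
    and A: "(\<lambda>x. A x p) \<in> borel_measurable borel"
  shows "AE t in lborel. t \<ge> 0 \<longrightarrow> flow M p m t \<notin> N"
proof -
  have N [measurable]: "N \<in> sets borel" using null by (simp add: event_time_null_def)
  have "(m, p) \<in> states M" using m p by (simp add: states_def)
  then have "(\<Sum>n. discounted_reset M A r N n (m, p)) = 0"
    using null by (simp add: event_time_null_def expected_discounted_resets_def)
  then have "discounted_reset M A r N 0 (m, p) = 0"
    using sum_le_suminf[of "\<lambda>n. discounted_reset M A r N n (m, p)" "{0}"] by (simp add: summableI)
  \<comment> \<open>Under the indicator \<open>max 0 t\<close> is t; it turns the integrand into a
    composition of functions known to be Borel on the line.\<close>
  moreover have "discounted_reset M A r N 0 (m, p) =
      (\<integral>\<^sup>+ t. indicator {0..} t * ennreal (exp (- \<rho> * t) * survival M A m p (max 0 t)) *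
        (ennreal \<kappa> * indicator N (flow M p m (max 0 t))) \<partial>lborel)"
    unfolding discounted_reset.simps prod.case
    by (rule nn_integral_cong) (simp add: indicator_def max_absorb2)
  ultimately have "(\<integral>\<^sup>+ t. indicator {0..} t * ennreal (exp (- \<rho> * t) * survival M A m p (max 0 t)) *
        (ennreal \<kappa> * indicator N (flow M p m (max 0 t))) \<partial>lborel) = 0"
    by simp
  moreover have "(\<lambda>t. (m, t)) \<in> borel \<rightarrow>\<^sub>M borel \<Otimes>\<^sub>M borel" by measurable
  from measurable_compose[OF this borel_measurable_survival[of A p, OF A]]
    measurable_compose[OF this borel_measurable_flow[of p]]
  have [measurable]: "(\<lambda>t. survival M A m p (max 0 t)) \<in> borel_measurable borel"
    "(\<lambda>t. flow M p m (max 0 t)) \<in> borel_measurable borel"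
    using m by (simp_all add: unit_clamp_id)
  ultimately have "AE t in lborel. indicator {0..} t * ennreal (exp (- \<rho> * t) * survival M A m p (max 0 t)) *
        (ennreal \<kappa> * indicator N (flow M p m (max 0 t))) = 0"
    by (subst (asm) nn_integral_0_iff_AE) measurable
  then show ?thesis
  proof eventually_elim
    case (elim t)
    have "exp (- \<rho> * t) * survival M A m p t > 0" by (simp add: survival_def)
    then show ?case
      using elim params by (auto simp: indicator_def max_absorb2 ennreal_eq_0_iff)
  qed
qed

text \<open>\<open>A\<close> is arbitrary so that the public and the strategic law are treated at
  once: survival weights are exponentials, hence positive, and the silence path is the same under
  both laws.\<close>

lemma cost_threshold_cong_null:
  assumes r: "exact_selector M r" and s: "exact_selector M s"
    and null: "event_time_null M A r (disagreement M r s)"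
    and A: "\<And>p. (\<lambda>x. A x p) \<in> borel_measurable borel"
  shows "cost_threshold M r = cost_threshold M s"
proof -
  have "strategic_operator M r f x = strategic_operator M s f x"
    if f: "f \<in> bounded_borel M" and x: "x \<in> states M" for f x
  proof -
    obtain m p where mp: "x = (m, p)" "m \<in> {0..1}" "p \<in> price_menu M"
      using x by (auto simp: states_def)
    show ?thesis
      unfolding mp strategic_operator_eq set_lebesgue_integral_def
    proof (rule integral_cong_AE)
      show "AE t in lborel. indicator {0..} t *\<^sub>R (discount p m t * event_payoff r f p (flow M p m t))
        = indicator {0..} t *\<^sub>R (discount p m t * event_payoff s f p (flow M p m t))"
        using event_time_null_flow[OF null mp(2,3) A]
      proof eventually_elim
        case (elim t)
        have "r (flow M p m t, p) = s (flow M p m t, p)" if "t \<ge> 0"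
          using elim that mp flow_solves(3)[OF mp(2) that] by (auto simp: disagreement_def)
        then show ?case by (auto simp: indicator_def event_payoff_def)
      qed
    qed (use borel_measurable_integrand_at r s f mp in auto)
  qed
  \<comment> \<open>The operators agree on \<open>bounded_borel M\<close>, which is where the
    definite description looks for its fixed point.\<close>
  then have "strategic_value M r = strategic_value M s"
    unfolding strategic_value_def by (intro arg_cong[where f=The]) (auto simp: fun_eq_iff)
  then show ?thesis
    by (simp add: cost_threshold_def gross_gain_def)
qed

end

theorem theorem1:
  fixes M :: pricing_model and c :: real and r :: selector
  assumes "valid_model M" and "c > 0" and "exact_selector M r"
  shows
    "(sequentially_rational M c r \<longleftrightarrow> c \<ge> cost_threshold M r)
   \<and> (c > cost_threshold M r \<longrightarrow>
        (\<exists>\<eta>>0. \<forall>(m, p)\<in>states M. gross_gain M r m p - c \<le> - \<eta>))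
   \<and> (\<forall>s. exact_selector M s \<and> (\<exists>x\<in>states M. strategic_value M r x \<noteq> strategic_value M s x) \<longrightarrow>
        (\<forall>c'>0. (sequentially_rational M c' r \<longleftrightarrow> c' \<ge> cost_threshold M r) \<and>
                (sequentially_rational M c' s \<longleftrightarrow> c' \<ge> cost_threshold M s)))
   \<and> (\<forall>s. exact_selector M s \<and>
          (\<forall>m\<in>disagreement M r s. m isolated_in tie_beliefs M) \<and>
          (event_time_null M (A_bar M) r (disagreement M r s) \<or>
           event_time_null M (A_L M) r (disagreement M r s)) \<longrightarrow>
        cost_threshold M r = cost_threshold M s)"
proof -
  interpret pricing_market M by standard (rule assms(1))
  note r = assms(3)
  have margin: "\<exists>\<eta>>0. \<forall>(m, p)\<in>states M. gross_gain M r m p - c \<le> - \<eta>" if "c > cost_threshold M r"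
    using that gross_gain_le_threshold[OF r]
    by (intro exI[of _ "c - cost_threshold M r"]) auto
  have null: "cost_threshold M r = cost_threshold M s"
    if "exact_selector M s" "event_time_null M (A_bar M) r (disagreement M r s) \<or>
           event_time_null M (A_L M) r (disagreement M r s)" for s
    using that cost_threshold_cong_null[OF r] borel_measurable_model by blast
  \<comment> \<open>The clause on selectors with different values is the first equivalence again,
    for each of the two selectors and every cost.\<close>
  show ?thesis
    using margin null by (simp add: sequentially_rational_iff_threshold r)
qed

end
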